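(* Let $V_{\tilde S}$ be the function on $i(\mathbb{R}\setminus\{0\})$ given by $$V_{\tilde S}(it)= i\,[\,t\,\psi(t/2)-t\log(t/2)+1\,],\quad t>0,\qquad V_{\tilde S}(-it)=\overline{V_{\tilde S}(it)},\quad t>0.$$ Then $V_{\tilde S}$ has a representation $$V_{\tilde S}(it)=a_{\tilde S}+\int_{\mathbb{R}}\frac{1+itx}{it-x}\,m_{\tilde S}(dx),\qquad t\in\mathbb{R}\setminus\{0\},$$ with $a_{\tilde S}\in\mathbb{R}$ and $m_{\tilde S}$ a non-negative finite Borel measure on $\mathbb{R}$, in which $a_{\tilde S}=0$, the total mass is $m_{\tilde S}(\mathbb{R})=\gamma+\log 2-1$, and the characteristic function $\hat m_{\tilde S}(s)=\int_{\mathbb{R}}e^{isx}\,m_{\tilde S}(dx)$ satisfies, for all $s>0$, $$\hat m_{\tilde S}(s)=-1+\cosh(s)\left(\log(1+e^{-s})-\log(1-e^{-s})\right)+\frac{e^{-s}}{2}Ei(s)+\frac{e^{s}}{2}Ei(-s)=2\int_0^\infty\cos(sx)\,\frac{x}{1+x^2}\,\frac{1}{e^{\pi x}-1}\,dx .$$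
   Context: $\psi(z)=\frac{d}{dz}\log\Gamma(z)$ is the digamma function and $\gamma$ is Euler's constant. $Ei$ is the exponential integral function: $Ei(x)=-\int_{-x}^\infty\frac{e^{-t}}{t}\,dt$ for $x<0$, and for $x>0$ it is the principal value $Ei(x)=-\lim_{\epsilon\to0^+}\left[\int_{-x}^{-\epsilon}\frac{e^{-t}}{t}\,dt+\int_{\epsilon}^\infty\frac{e^{-t}}{t}\,dt\right]$, equivalently $Ei(x)=\gamma+\log x+\sum_{k=1}^\infty\frac{x^k}{k\cdot k!}$. *)

theory Defs
  imports "HOL-Probability.Probability"
begin

(* For x > 0 this is the principal value at the singularity 0.
   The value at x = 0 carries no meaning. *)
definition Ei :: "real \<Rightarrow> real" where
  "Ei x =
    (if x < 0 then - (LINT t:{-x<..}|lborel. exp (- t) / t)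
     else - Lim (at_right 0) (\<lambda>\<epsilon>.
            (LINT t:{-x<..< -\<epsilon>}|lborel. exp (- t) / t) + (LINT t:{\<epsilon><..}|lborel. exp (- t) / t)))"

end

theory Submission
  imports Defs "HOL-Real_Asymp.Real_Asymp"
begin

text \<open>
  Everything follows from two transforms of the weight \<open>x / (exp (pi * x) - 1)\<close> on the positive
  half-line.

  Binet's second formula for the digamma function (\<open>binet_Digamma\<close>) says that
  \<open>t * Digamma (t / 2) - t * ln (t / 2) + 1\<close> is \<open>- 2 * t\<close> times the integral of \<open>1 / (x\<^sup>2 + t\<^sup>2)\<close> against
  this weight. The part of the kernel \<open>(1 + \<i> t x) / (\<i> t - x)\<close> that is even in \<open>x\<close> is
  \<open>- \<i> t (1 + x\<^sup>2) / (x\<^sup>2 + t\<^sup>2)\<close>. Therefore the even extension of the weight, divided by \<open>1 + x\<^sup>2\<close>, is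
  the density of a representing measure with \<open>a = 0\<close> (\<open>pick_kernel_integral\<close>). Its mass is Binet's
  formula at \<open>t = 1\<close>, where \<open>Digamma (1/2) = - \<gamma> - 2 * ln 2\<close>, and its characteristic function is the
  cosine integral \<open>F s\<close> of \<open>2 * cos (s * x) / (1 + x\<^sup>2)\<close> against the weight.

  Binet's formula is derived from the sine transform \<open>a s = coth s - 1 / s\<close> of \<open>2 / (exp (pi * x) - 1)\<close>
  (\<open>integral_sin_bose\<close>), which comes from a geometric series and the partial fractions of \<open>coth\<close>. The
  Laplace transform of \<open>a\<close> is Binet's integral by Fubini, it satisfies the same difference equation in \<open>t\<close>
  as the digamma expression, and both vanish at infinity.

  For the closed form of \<open>F\<close>, let \<open>H s\<close> be the integral of \<open>2 * sin (s * x) / (x * (1 + x\<^sup>2))\<close>. Then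
  \<open>H' = F\<close> and \<open>F' = H - a\<close>, so \<open>F + H\<close> and \<open>F - H\<close> solve the decoupled equations \<open>u' = u - a\<close> and
  \<open>u' = - u - a\<close>. The expressions \<open>- 1 + exp s * (L s + Ei (- s))\<close> and \<open>- 1 + exp (- s) * (L s + Ei s)\<close>,
  where \<open>L s = ln (1 + exp (- s)) - ln (1 - exp (- s))\<close>, solve them too. Growth at infinity settles the
  first equation and the value at \<open>0\<close> the second one (\<open>bose_cos_plus_sin\<close>, \<open>bose_cos_minus_sin\<close>). The
  value at \<open>0\<close> requires \<open>Ei x = \<gamma> + ln \<bar>x\<bar> + \<dots>\<close> (\<open>Ei_eq\<close>), whose constant is read off from
  Binet's formula at \<open>t = 2\<close>.
\<close>

section \<open>Integration on half-lines and under the integral sign\<close>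

lemma FTC_Ioi_integrable:
  fixes f F :: "real \<Rightarrow> real"
  assumes F: "\<And>x. x > a \<Longrightarrow> (F has_real_derivative f x) (at x)"
    and f: "\<And>x. x > a \<Longrightarrow> isCont f x"
    and int: "set_integrable lborel {a<..} f"
    and A: "(F \<longlongrightarrow> A) (at_right a)" and B: "(F \<longlongrightarrow> B) at_top"
  shows "(LINT x:{a<..}|lborel. f x) = B - A"
proof -
  have E: "einterval (ereal a) \<infinity> = {a<..}" by (auto simp: einterval_def)
  have "(LBINT x=ereal a..\<infinity>. f x) = B - A"
    by (rule interval_integral_FTC_integrable[where F = F])
      (use assms E in \<open>auto simp: ereal_tendsto_simps has_real_derivative_iff_has_vector_derivative\<close>)
  then show ?thesis
    by (simp add: interval_lebesgue_integral_def E)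
qed

lemma FTC_Ioi_nonneg:
  fixes f F :: "real \<Rightarrow> real"
  assumes F: "\<And>x. x > a \<Longrightarrow> (F has_real_derivative f x) (at x)"
    and f: "\<And>x. x > a \<Longrightarrow> isCont f x" and nonneg: "\<And>x. x > a \<Longrightarrow> 0 \<le> f x"
    and A: "(F \<longlongrightarrow> A) (at_right a)" and B: "(F \<longlongrightarrow> B) at_top"
  shows "set_integrable lborel {a<..} f" "(LINT x:{a<..}|lborel. f x) = B - A"
proof -
  have E: "einterval (ereal a) \<infinity> = {a<..}" by (auto simp: einterval_def)
  have "set_integrable lborel (einterval (ereal a) \<infinity>) f"
    by (rule interval_integral_FTC_nonneg(1)[where F = F])
      (use assms E in \<open>auto simp: ereal_tendsto_simps\<close>)
  then show *: "set_integrable lborel {a<..} f" by (simp add: E)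
  show "(LINT x:{a<..}|lborel. f x) = B - A"
    by (rule FTC_Ioi_integrable[OF F f * A B])
qed

text \<open>
  Dominated convergence for the difference quotients: \<open>w\<close> dominates them because of the Lipschitz
  condition. Asking for the derivative only almost everywhere admits integrands such as
  \<open>sin (u * x) / x\<close>, whose totalised value at \<open>x = 0\<close> has the wrong derivative.
\<close>

lemma has_real_derivative_integral:
  fixes f :: "real \<Rightarrow> 'a \<Rightarrow> real"
  assumes U: "open U" "s \<in> U"
    and int: "\<And>u. u \<in> U \<Longrightarrow> integrable M (f u)"
    and deriv: "AE x in M. ((\<lambda>u. f u x) has_real_derivative f' x) (at s)"
    and meas: "f' \<in> borel_measurable M"
    and lip: "\<And>u x. u \<in> U \<Longrightarrow> x \<in> space M \<Longrightarrow> \<bar>f u x - f s x\<bar> \<le> w x * \<bar>u - s\<bar>"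
    and w: "integrable M w"
  shows "((\<lambda>u. \<integral>x. f u x \<partial>M) has_real_derivative (\<integral>x. f' x \<partial>M)) (at s)"
proof -
  have "((\<lambda>u. ((\<integral>x. f u x \<partial>M) - (\<integral>x. f s x \<partial>M)) / (u - s)) \<longlongrightarrow> (\<integral>x. f' x \<partial>M)) (at s within U)"
    unfolding tendsto_at_iff_sequentially
  proof (intro allI impI)
    fix X :: "nat \<Rightarrow> real" assume X: "\<forall>i. X i \<in> U - {s}" and lim: "X \<longlonglongrightarrow> s"
    have "(\<lambda>i. \<integral>x. (f (X i) x - f s x) / (X i - s) \<partial>M) \<longlonglongrightarrow> (\<integral>x. f' x \<partial>M)"
    proof (rule integral_dominated_convergence[OF meas _ w])
      show "(\<lambda>x. (f (X i) x - f s x) / (X i - s)) \<in> borel_measurable M" for i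
        using int[of "X i"] int[of s] X U by (auto intro!: borel_measurable_divide borel_measurable_diff)
      show "AE x in M. norm ((f (X i) x - f s x) / (X i - s)) \<le> w x" for i
        using lip[of "X i"] X by (auto simp: divide_le_eq abs_mult)
      show "AE x in M. (\<lambda>i. (f (X i) x - f s x) / (X i - s)) \<longlonglongrightarrow> f' x"
        using deriv
      proof eventually_elim
        fix x assume "((\<lambda>u. f u x) has_real_derivative f' x) (at s)"
        then have "((\<lambda>u. (f u x - f s x) / (u - s)) \<longlongrightarrow> f' x) (at s)"
          by (simp add: has_field_derivative_iff)
        then show "(\<lambda>i. (f (X i) x - f s x) / (X i - s)) \<longlonglongrightarrow> f' x"
          using X lim by (auto simp: tendsto_at_iff_sequentially o_def)
      qed
    qed
    moreover have "(\<integral>x. (f (X i) x - f s x) / (X i - s) \<partial>M) =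
        ((\<integral>x. f (X i) x \<partial>M) - (\<integral>x. f s x \<partial>M)) / (X i - s)" for i
      by (subst integral_divide_zero, subst Bochner_Integration.integral_diff) (use int X U in auto)
    ultimately show "((\<lambda>u. ((\<integral>x. f u x \<partial>M) - (\<integral>x. f s x \<partial>M)) / (u - s)) \<circ> X) \<longlonglongrightarrow> (\<integral>x. f' x \<partial>M)"
      by (simp only: o_def)
  qed
  then show ?thesis
    unfolding has_field_derivative_iff at_within_open[OF U(2,1)] .
qed

section \<open>The weight x / (exp (pi x) - 1) on the positive half-line\<close>

text \<open>
  The weight includes the factor \<open>x\<close>, which cancels the pole of \<open>1 / (exp (pi * x) - 1)\<close> at \<open>0\<close>.
  This makes the measure finite, so that every bounded Borel function is integrable and no singular
  integrand has to be discussed; a factor \<open>1 / x\<close> is put back into the integrands that need it,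
  always next to a sine.
\<close>

definition bose_measure :: "real measure" where
  "bose_measure = density lborel (\<lambda>x. ennreal (indicator {0<..} x * (x / (exp (pi * x) - 1))))"

lemma space_bose_measure [simp]: "space bose_measure = UNIV"
  and sets_bose_measure [simp, measurable_cong]: "sets bose_measure = sets borel"
  by (auto simp: bose_measure_def)

text \<open>
  The upper bound is \<open>sinh y \<ge> y\<close> at \<open>y = pi * x / 2\<close>, rewritten with
  \<open>exp (2 * y) - 1 = 2 * exp y * sinh y\<close>.
\<close>

lemma bose_density_bound:
  fixes x :: real
  assumes "x > 0"
  shows "0 < x / (exp (pi * x) - 1)" "x / (exp (pi * x) - 1) \<le> exp (- (x * (pi / 2))) / pi"
proof -
  have gt: "exp (pi * x) > 1" using assms by simp
  then show "0 < x / (exp (pi * x) - 1)" using assms by simp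
  have "pi * x / 2 \<le> sinh (pi * x / 2)"
  proof -
    have "sinh 0 - 0 \<le> sinh (pi * x / 2) - pi * x / 2"
    proof (rule DERIV_nonneg_imp_nondecreasing[where f = "\<lambda>y. sinh y - y"])
      show "0 \<le> pi * x / 2" using assms by simp
      fix y :: real
      have "((\<lambda>y. sinh y - y) has_real_derivative cosh y - 1) (at y)"
        by (auto intro!: derivative_eq_intros)
      moreover have "cosh y - 1 \<ge> 0" using cosh_real_ge_1[of y] by simp
      ultimately show "\<exists>d. ((\<lambda>y. sinh y - y) has_real_derivative d) (at y) \<and> 0 \<le> d" by blast
    qed
    then show ?thesis by simp
  qed
  then have "pi * x \<le> exp (pi * x / 2) - exp (- (pi * x / 2))"
    by (simp add: sinh_field_def)
  then have "exp (pi * x / 2) * (pi * x) \<le> exp (pi * x / 2) * (exp (pi * x / 2) - exp (- (pi * x / 2)))"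
    by simp
  also have "\<dots> = exp (pi * x) - 1"
    by (simp add: algebra_simps flip: exp_add)
  finally have "exp (x * (pi / 2)) * pi * x \<le> exp (pi * x) - 1" by (simp add: mult_ac)
  then show "x / (exp (pi * x) - 1) \<le> exp (- (x * (pi / 2))) / pi"
    using gt assms by (simp add: exp_minus field_simps)
qed

lemma integrable_bose_density:
  "set_integrable lborel {0<..} (\<lambda>x::real. x / (exp (pi * x) - 1))"
proof -
  have "set_integrable lborel {0<..} (\<lambda>x::real. exp (- (x * (pi / 2))) / pi)"
    using integrable_I0i_exp_mscale[of "pi / 2"] by simp
  then show ?thesis
    by (rule set_integrable_bound)
      (use bose_density_bound in \<open>auto simp: set_borel_measurable_def intro!: AE_I2\<close>)
qed

lemma integral_bose_measure:
  fixes f :: "real \<Rightarrow> 'b :: {banach, second_countable_topology}"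
  assumes [measurable]: "f \<in> borel_measurable borel"
  shows "(\<integral>x. f x \<partial>bose_measure) = (LINT x:{0<..}|lborel. (x / (exp (pi * x) - 1)) *\<^sub>R f x)"
  unfolding bose_measure_def set_lebesgue_integral_def
  by (subst integral_density) (auto intro!: AE_I2 simp: indicator_def mult_ac)

interpretation bose: finite_measure bose_measure
proof
  let ?f = "\<lambda>x::real. indicator {0<..} x * (x / (exp (pi * x) - 1))"
  have "emeasure bose_measure (space bose_measure) = (\<integral>\<^sup>+x. ennreal (?f x) \<partial>lborel)"
    by (simp add: bose_measure_def emeasure_density)
  also have "\<dots> = (\<integral>\<^sup>+x. ennreal (norm (?f x)) \<partial>lborel)"
    using bose_density_bound(1) by (intro nn_integral_cong) (force simp: indicator_def)
  also have "\<dots> < \<infinity>"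
  proof -
    have "integrable lborel ?f"
      using integrable_bose_density by (simp only: set_integrable_def real_scaleR_def)
    then show ?thesis by (simp only: integrable_iff_bounded)
  qed
  finally show "emeasure bose_measure (space bose_measure) \<noteq> \<infinity>" by simp
qed

lemma integrable_bose_measure:
  fixes f :: "real \<Rightarrow> real"
  assumes "f \<in> borel_measurable borel" "\<And>x. \<bar>f x\<bar> \<le> B"
  shows "integrable bose_measure f"
  by (rule bose.integrable_const_bound[where B = B]) (use assms in auto)

lemma AE_bose_measure_pos: "AE x in bose_measure. x > 0"
  unfolding bose_measure_def by (subst AE_density) (auto simp: indicator_def)

section \<open>The sine transform of the weight\<close>

lemma
  fixes a :: real
  assumes "a > 0"
  shows integrable_x_exp: "set_integrable lborel {0<..} (\<lambda>x. x * exp (- (x * a)))"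
    and integral_x_exp: "(LINT x:{0<..}|lborel. x * exp (- (x * a))) = 1 / a\<^sup>2"
proof -
  have a: "a \<noteq> 0" using assms by simp
  let ?F = "\<lambda>x. - (x / a + 1 / a\<^sup>2) * exp (- (x * a))"
  have D: "(?F has_real_derivative x * exp (- (x * a))) (at x)" for x
    using a by (auto intro!: derivative_eq_intros simp: a field_simps power2_eq_square)
  have A: "(?F \<longlongrightarrow> - (1 / a\<^sup>2)) (at_right 0)"
    using a by (auto intro!: tendsto_eq_intros)
  have B: "(?F \<longlongrightarrow> 0) at_top"
    using assms by real_asymp
  note * = FTC_Ioi_nonneg[OF D _ _ A B]
  show "set_integrable lborel {0<..} (\<lambda>x. x * exp (- (x * a)))"
    by (rule *(1)) (auto intro!: continuous_intros)
  show "(LINT x:{0<..}|lborel. x * exp (- (x * a))) = 1 / a\<^sup>2"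
    by (subst *(2)) (auto intro!: continuous_intros)
qed

lemma
  fixes a s :: real
  assumes a: "a > 0"
  shows integrable_exp_sin: "set_integrable lborel {0<..} (\<lambda>x. exp (- (x * a)) * sin (s * x))"
    and integral_exp_sin: "(LINT x:{0<..}|lborel. exp (- (x * a)) * sin (s * x)) = s / (s\<^sup>2 + a\<^sup>2)"
proof -
  let ?F = "\<lambda>x. - (exp (- (x * a)) * (a * sin (s * x) + s * cos (s * x))) / (s\<^sup>2 + a\<^sup>2)"
  have pos: "s\<^sup>2 + a\<^sup>2 > 0" using a by (simp add: add_nonneg_pos)
  show int: "set_integrable lborel {0<..} (\<lambda>x. exp (- (x * a)) * sin (s * x))"
    by (rule set_integrable_bound[OF integrable_I0i_exp_mscale[OF a]])
      (auto simp: set_borel_measurable_def abs_mult)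
  have D: "(?F has_real_derivative exp (- (x * a)) * sin (s * x)) (at x)" for x
  proof -
    have "((\<lambda>x. exp (- (x * a)) * (a * sin (s * x) + s * cos (s * x))) has_real_derivative
        exp (- (x * a)) * (- a) * (a * sin (s * x) + s * cos (s * x)) +
           (a * (cos (s * x) * s) - s * (sin (s * x) * s)) * exp (- (x * a))) (at x)"
      by (auto intro!: derivative_eq_intros)
    also have "exp (- (x * a)) * (- a) * (a * sin (s * x) + s * cos (s * x)) +
           (a * (cos (s * x) * s) - s * (sin (s * x) * s)) * exp (- (x * a)) =
        - (exp (- (x * a)) * sin (s * x) * (s\<^sup>2 + a\<^sup>2))"
      by (simp add: algebra_simps power2_eq_square)
    finally have "((\<lambda>x. exp (- (x * a)) * (a * sin (s * x) + s * cos (s * x))) has_real_derivative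
        - (exp (- (x * a)) * sin (s * x) * (s\<^sup>2 + a\<^sup>2))) (at x)" .
    from DERIV_cdivide[OF DERIV_minus[OF this], of "s\<^sup>2 + a\<^sup>2"]
    show ?thesis using a by simp
  qed
  have "((\<lambda>x. exp (- (x * a)) * (a * sin (s * x) + s * cos (s * x))) \<longlongrightarrow> 0) at_top"
  proof (rule Lim_null_comparison)
    show "((\<lambda>x. exp (- (x * a)) * (a + \<bar>s\<bar>)) \<longlongrightarrow> 0) at_top"
      using a by real_asymp
    have "\<bar>a * sin (s * x) + s * cos (s * x)\<bar> \<le> a + \<bar>s\<bar>" for x
    proof -
      have "\<bar>a * sin (s * x)\<bar> \<le> a * 1" "\<bar>s * cos (s * x)\<bar> \<le> \<bar>s\<bar> * 1"
        unfolding abs_mult using a by (auto intro!: mult_mono mult_left_le simp del: mult_1_right)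
      then show ?thesis by linarith
    qed
    then show "\<forall>\<^sub>F x in at_top. norm (exp (- (x * a)) * (a * sin (s * x) + s * cos (s * x)))
        \<le> exp (- (x * a)) * (a + \<bar>s\<bar>)"
      by (simp add: abs_mult)
  qed
  from tendsto_divide[OF tendsto_minus[OF this] tendsto_const[of "s\<^sup>2 + a\<^sup>2"]]
  have B: "(?F \<longlongrightarrow> 0) at_top" using a by simp
  have A: "(?F \<longlongrightarrow> - s / (s\<^sup>2 + a\<^sup>2)) (at_right 0)"
    using pos by (auto intro!: tendsto_eq_intros)
  show "(LINT x:{0<..}|lborel. exp (- (x * a)) * sin (s * x)) = s / (s\<^sup>2 + a\<^sup>2)"
    by (subst FTC_Ioi_integrable[OF D _ int A B]) (auto intro!: continuous_intros)
qed

text \<open>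
  The logarithmic derivative of Euler's reflection formula. In terms of
  \<open>1 / \<Gamma>\<close> it reads \<open>rGamma z * rGamma (1 - z) = sin (pi * z) / pi\<close>, with no quotient of functions to
  differentiate.
\<close>

lemma Digamma_reflection_complex:
  fixes z :: complex
  assumes "z \<notin> \<int>"
  shows "Digamma (1 - z) - Digamma z = of_real pi * cot (of_real pi * z)"
proof -
  have nz: "z \<notin> \<int>\<^sub>\<le>\<^sub>0" "1 - z \<notin> \<int>\<^sub>\<le>\<^sub>0"
    using assms nonpos_Ints_subset_Ints Ints_diff[of 1 "1 - z"] by auto
  have "((\<lambda>z. rGamma z * rGamma (1 - z)) has_field_derivative
      - rGamma z * Digamma z * rGamma (1 - z) + rGamma (1 - z) * Digamma (1 - z) * rGamma z) (at z)"
    using nz by (auto intro!: derivative_eq_intros)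
  moreover have "((\<lambda>z. rGamma z * rGamma (1 - z)) has_field_derivative cos (of_real pi * z)) (at z)"
    unfolding rGamma_reflection_complex by (auto intro!: derivative_eq_intros)
  ultimately have "- rGamma z * Digamma z * rGamma (1 - z) + rGamma (1 - z) * Digamma (1 - z) * rGamma z
      = cos (of_real pi * z)"
    by (rule DERIV_unique)
  then have "rGamma z * rGamma (1 - z) * (Digamma (1 - z) - Digamma z) = cos (of_real pi * z)"
    by (simp add: algebra_simps)
  moreover have "sin (of_real pi * z) \<noteq> 0"
    using rGamma_reflection_complex[of z] nz by (auto simp: rGamma_eq_zero_iff)
  ultimately show ?thesis
    by (simp add: rGamma_reflection_complex cot_def field_simps)
qed

text \<open>
  The reflection formula on the imaginary axis, at \<open>z = \<i> * s / pi\<close>, where \<open>cot\<close> becomes \<open>coth\<close>. In the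
  difference \<open>Digamma (1 - z) - Digamma (1 + z)\<close> the logarithms of the limit formula for Digamma cancel
  and what remains is the partial fraction series.
\<close>

lemma coth_partial_fractions:
  fixes s :: real
  assumes "s \<noteq> 0"
  shows "(\<lambda>n. 2 * (s / (s\<^sup>2 + (real (Suc n) * pi)\<^sup>2))) sums (cosh s / sinh s - 1 / s)"
proof -
  \<comment> \<open>Both sides of the limit are purely imaginary, so nothing is lost by comparing imaginary parts.\<close>
  define y where "y = s / pi"
  define z where "z = \<i> * complex_of_real y"
  have y: "y \<noteq> 0" using assms by (simp add: y_def)
  have zI: "z \<notin> \<int>"
    using y by (auto simp: z_def complex_is_Int_iff)
  have "(\<lambda>n. ((\<Sum>k<n. inverse (1 + z + of_nat k)) - (\<Sum>k<n. inverse (1 - z + of_nat k))))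
      \<longlonglongrightarrow> Digamma (1 - z) - Digamma (1 + z)"
  proof -
    have "1 - z \<noteq> 0" "1 + z \<noteq> 0" by (auto simp: z_def complex_eq_iff)
    from tendsto_diff[OF Digamma_LIMSEQ[OF this(1)] Digamma_LIMSEQ[OF this(2)]]
    show ?thesis by simp
  qed
  moreover have "Digamma (1 + z) = Digamma z + 1 / z"
    using Digamma_plus1[of z] y by (simp add: z_def add.commute)
  ultimately have "(\<lambda>n. (\<Sum>k<n. inverse (1 + z + of_nat k) - inverse (1 - z + of_nat k)))
      \<longlonglongrightarrow> of_real pi * cot (of_real pi * z) - 1 / z"
    using Digamma_reflection_complex[OF zI] by (simp add: sum_subtractf algebra_simps)
  then have "(\<lambda>n. Im (\<Sum>k<n. inverse (1 + z + of_nat k) - inverse (1 - z + of_nat k)))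
      \<longlonglongrightarrow> Im (of_real pi * cot (of_real pi * z) - 1 / z)"
    by (rule tendsto_Im)
  moreover have "Im (inverse (1 + z + of_nat k) - inverse (1 - z + of_nat k)) =
      - pi * (2 * (s / (s\<^sup>2 + (real (Suc k) * pi)\<^sup>2)))" for k
  proof -
    have "Im (inverse (1 + z + of_nat k) - inverse (1 - z + of_nat k)) = - (2 * y / ((real (Suc k))\<^sup>2 + y\<^sup>2))"
      by (simp add: z_def add_ac)
    also have "(real (Suc k))\<^sup>2 + y\<^sup>2 = (s\<^sup>2 + (real (Suc k) * pi)\<^sup>2) / pi\<^sup>2"
      by (simp add: y_def field_simps power2_eq_square)
    finally show ?thesis by (simp add: y_def field_simps power2_eq_square)
  qed
  moreover have "Im (of_real pi * cot (of_real pi * z) - 1 / z) = - pi * (cosh s / sinh s - 1 / s)"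
  proof -
    have "of_real pi * z = \<i> * of_real s" by (simp add: z_def y_def)
    moreover have "cosh (complex_of_real s) = of_real (cosh s)" "sinh (complex_of_real s) = of_real (sinh s)"
      by (simp_all add: sinh_field_def cosh_field_def exp_of_real flip: of_real_minus)
    ultimately have "cot (of_real pi * z) = of_real (cosh s) / (\<i> * of_real (sinh s))"
      by (simp add: cot_def sin_conv_sinh cos_conv_cosh)
    then have "cot (of_real pi * z) = - \<i> * of_real (cosh s / sinh s)"
      by (simp only: divide_divide_eq_left[symmetric] divide_i) simp
    moreover have "1 / z = - \<i> * of_real (pi / s)"
      using assms by (simp add: z_def y_def field_simps)
    ultimately show ?thesis by (simp add: field_simps)
  qed
  ultimately have "(\<lambda>n. - pi * (\<Sum>k<n. 2 * (s / (s\<^sup>2 + (real (Suc k) * pi)\<^sup>2))))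
      \<longlonglongrightarrow> - pi * (cosh s / sinh s - 1 / s)"
    by (simp add: sum_distrib_left)
  then show ?thesis
    unfolding sums_def by (subst (asm) tendsto_mult_left_iff) auto
qed

text \<open>
  Expanding \<open>1 / (exp (pi * x) - 1)\<close> into the geometric series of \<open>exp (- pi * x)\<close> and integrating term
  by term gives the partial fraction series of \<open>coth\<close>. The interchange is justified by
  \<open>\<bar>sin (s * x)\<bar> \<le> s * x\<close>, which makes the integrals of the absolute values \<open>O(1 / n\<^sup>2)\<close>.
\<close>

lemma integral_sin_bose:
  fixes s :: real
  assumes s: "s > 0"
  shows "2 * (\<integral>x. sin (s * x) / x \<partial>bose_measure) = cosh s / sinh s - 1 / s"
proof -
  let ?f = "\<lambda>n x. indicator {0<..} x *\<^sub>R (exp (- (x * (real (Suc n) * pi))) * sin (s * x))"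
  have int: "integrable lborel (?f n)" for n
    using integrable_exp_sin[of "real (Suc n) * pi" s] by (simp add: set_integrable_def)
  have val: "integral\<^sup>L lborel (?f n) = s / (s\<^sup>2 + (real (Suc n) * pi)\<^sup>2)" for n
    using integral_exp_sin[of "real (Suc n) * pi" s] by (simp add: set_lebesgue_integral_def)
  have geo: "(\<lambda>n. exp (- (x * (real (Suc n) * pi)))) sums (1 / (exp (pi * x) - 1))" if "x > 0" for x
  proof -
    have "exp (- (pi * x)) < 1" using that by simp
    from sums_mult[OF geometric_sums[of "exp (- (pi * x))"], of "exp (- (pi * x))"] this
    have "(\<lambda>n. exp (- (pi * x)) * exp (- (pi * x)) ^ n) sums (exp (- (pi * x)) * (1 / (1 - exp (- (pi * x)))))"
      by simp
    moreover have "exp (- (pi * x)) * (1 / (1 - exp (- (pi * x)))) = 1 / (exp (pi * x) - 1)"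
      using that by (simp add: exp_minus field_simps)
    moreover have "exp (- (pi * x)) * exp (- (pi * x)) ^ n = exp (- (x * (real (Suc n) * pi)))" for n
      by (simp add: exp_of_nat_mult [symmetric] exp_add [symmetric] algebra_simps)
    ultimately show ?thesis by simp
  qed
  have sum: "(\<lambda>n. ?f n x) sums (indicator {0<..} x *\<^sub>R (x / (exp (pi * x) - 1) * (sin (s * x) / x)))" for x
  proof (cases "x > 0")
    case True
    from sums_mult2[OF geo[OF True], of "sin (s * x)"] True show ?thesis by simp
  qed simp
  have abs_sum: "summable (\<lambda>n. norm (?f n x))" for x
  proof (cases "x > 0")
    case True
    from sums_mult2[OF geo[OF True], of "\<bar>sin (s * x)\<bar>"] True show ?thesis
      by (simp add: abs_mult sums_iff)
  qed simp
  have norm_bound: "(\<integral>x. norm (?f n x) \<partial>lborel) \<le> s / pi\<^sup>2 * (1 / (real (Suc n))\<^sup>2)" for n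
  proof -
    let ?a = "real (Suc n) * pi"
    have "(\<integral>x. norm (?f n x) \<partial>lborel) \<le> (\<integral>x. s * (indicator {0<..} x *\<^sub>R (x * exp (- (x * ?a)))) \<partial>lborel)"
    proof (rule integral_mono)
      show "integrable lborel (\<lambda>x. s * (indicator {0<..} x *\<^sub>R (x * exp (- (x * ?a)))))"
        using integrable_x_exp[of ?a] by (simp add: set_integrable_def)
      fix x :: real
      show "norm (?f n x) \<le> s * (indicator {0<..} x *\<^sub>R (x * exp (- (x * ?a))))"
        using abs_sin_x_le_abs_x[of "s * x"] s
        by (auto simp: indicator_def abs_mult mult_ac)
    qed (use int in auto)
    also have "\<dots> = s * (1 / ?a\<^sup>2)"
      using integral_x_exp[of ?a] by (simp add: set_lebesgue_integral_def)
    finally show ?thesis by (simp add: power_mult_distrib mult_ac)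
  qed
  have sq: "summable (\<lambda>n. 1 / (real (Suc n))\<^sup>2)"
    using inverse_power_summable[of 2, where ?'a = real]
    by (subst summable_Suc_iff) (simp add: inverse_eq_divide)
  have "(\<lambda>n. integral\<^sup>L lborel (?f n)) sums (\<integral>x. (\<Sum>n. ?f n x) \<partial>lborel)"
  proof (rule sums_integral)
    show "summable (\<lambda>n. \<integral>x. norm (?f n x) \<partial>lborel)"
      by (rule summable_comparison_test'[OF summable_mult[OF sq, of "s / pi\<^sup>2"]])
        (use norm_bound in \<open>simp add: integral_nonneg_AE\<close>)
  qed (use int abs_sum in auto)
  also have "(\<lambda>x. \<Sum>n. ?f n x) = (\<lambda>x. indicator {0<..} x *\<^sub>R (x / (exp (pi * x) - 1) * (sin (s * x) / x)))"
    using sum by (auto simp: sums_iff)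
  also have "integral\<^sup>L lborel \<dots> = (\<integral>x. sin (s * x) / x \<partial>bose_measure)"
    by (subst integral_bose_measure) (simp_all add: set_lebesgue_integral_def)
  finally have "(\<lambda>n. s / (s\<^sup>2 + (real (Suc n) * pi)\<^sup>2)) sums (\<integral>x. sin (s * x) / x \<partial>bose_measure)"
    unfolding val .
  from sums_mult[OF this, of 2] coth_partial_fractions[of s] s
  show ?thesis by (auto dest: sums_unique2)
qed

section \<open>Binet's formula for the digamma function\<close>

text \<open>
  The kernel \<open>1 / (x\<^sup>2 + t\<^sup>2)\<close> is the Laplace transform of \<open>sin (s * x) / x\<close> in the variable \<open>s\<close>, so
  Fubini turns Binet's integral into the Laplace transform of the sine transform above. The double
  integral converges absolutely because \<open>\<bar>sin (s * x) / x\<bar> \<le> s\<close> and the weight is finite.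
\<close>

lemma
  fixes t :: real
  assumes t: "t > 0"
  shows integrable_laplace_coth:
      "set_integrable lborel {0<..} (\<lambda>s. exp (- (s * t)) * (cosh s / sinh s - 1 / s))"
    and integral_laplace_coth:
      "(LINT s:{0<..}|lborel. exp (- (s * t)) * (cosh s / sinh s - 1 / s)) =
        2 * (\<integral>x. 1 / (x\<^sup>2 + t\<^sup>2) \<partial>bose_measure)"
proof -
  let ?f = "\<lambda>x s :: real. indicator {0<..} s *\<^sub>R (exp (- (s * t)) * (sin (s * x) / x))"
  interpret P: pair_sigma_finite bose_measure lborel ..
  have bound: "norm (?f x s) \<le> indicator {0<..} s *\<^sub>R (s * exp (- (s * t)))" for x s
  proof (cases "x = 0 \<or> s \<le> 0")
    case False
    then have "\<bar>sin (s * x)\<bar> / \<bar>x\<bar> \<le> s"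
      using abs_sin_x_le_abs_x[of "s * x"] by (simp add: abs_mult divide_le_eq)
    from mult_right_mono[OF this, of "exp (- (s * t))"] show ?thesis
      using False by (simp add: abs_mult mult.commute)
  qed (auto simp: indicator_def)
  have int_dom: "integrable lborel (\<lambda>s. indicator {0<..} s *\<^sub>R (s * exp (- (s * t))))"
    using integrable_x_exp[OF t] by (simp add: set_integrable_def)
  have int_x: "integrable lborel (?f x)" for x
    by (rule Bochner_Integration.integrable_bound[OF int_dom])
      (use order_trans[OF bound abs_ge_self] in \<open>simp_all only: real_norm_def AE_I2, measurable\<close>)
  have int: "integrable (bose_measure \<Otimes>\<^sub>M lborel) (\<lambda>(x, s). ?f x s)"
  proof (rule P.Fubini_integrable)
    have "\<bar>\<integral>s. norm (?f x s) \<partial>lborel\<bar> \<le> (\<integral>s. indicator {0<..} s *\<^sub>R (s * exp (- (s * t))) \<partial>lborel)" for x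
      using integral_mono[OF integrable_norm[OF int_x[of x]] int_dom] bound
      by (simp add: integral_nonneg_AE)
    then have "integrable bose_measure (\<lambda>x. \<integral>s. norm (?f x s) \<partial>lborel)"
      by (intro integrable_bose_measure) auto
    then show "integrable bose_measure (\<lambda>x. \<integral>s. norm (case (x, s) of (x, s) \<Rightarrow> ?f x s) \<partial>lborel)"
      by simp
  qed (use int_x in auto)
  have inner: "2 * (\<integral>x. ?f x s \<partial>bose_measure) =
      indicator {0<..} s *\<^sub>R (exp (- (s * t)) * (cosh s / sinh s - 1 / s))" for s
  proof (cases "s > 0")
    case True
    have "2 * (\<integral>x. ?f x s \<partial>bose_measure) = exp (- (s * t)) * (2 * (\<integral>x. sin (s * x) / x \<partial>bose_measure))"
      using True by (simp del: times_divide_eq_right)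
    then show ?thesis using integral_sin_bose[OF True] True by simp
  qed simp
  have "integrable lborel (\<lambda>s. 2 * (\<integral>x. ?f x s \<partial>bose_measure))"
    using P.integrable_snd[OF int] by simp
  then show "set_integrable lborel {0<..} (\<lambda>s. exp (- (s * t)) * (cosh s / sinh s - 1 / s))"
    unfolding inner set_integrable_def .
  have "(LINT s:{0<..}|lborel. exp (- (s * t)) * (cosh s / sinh s - 1 / s)) =
      (\<integral>s. 2 * (\<integral>x. ?f x s \<partial>bose_measure) \<partial>lborel)"
    unfolding inner set_lebesgue_integral_def ..
  also have "\<dots> = 2 * (\<integral>x. (\<integral>s. ?f x s \<partial>lborel) \<partial>bose_measure)"
    using P.Fubini_integral[OF int] by simp
  also have "(\<integral>x. (\<integral>s. ?f x s \<partial>lborel) \<partial>bose_measure) = (\<integral>x. 1 / (x\<^sup>2 + t\<^sup>2) \<partial>bose_measure)"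
  proof (rule integral_cong_AE)
    show "AE x in bose_measure. (\<integral>s. ?f x s \<partial>lborel) = 1 / (x\<^sup>2 + t\<^sup>2)"
      using AE_bose_measure_pos
    proof eventually_elim
      fix x :: real assume x: "x > 0"
      have "(\<integral>s. ?f x s \<partial>lborel) = (\<integral>s. indicator {0<..} s *\<^sub>R (exp (- (s * t)) * sin (x * s)) / x \<partial>lborel)"
        by (simp add: mult.commute)
      also have "\<dots> = x / (x\<^sup>2 + t\<^sup>2) / x"
        using integral_exp_sin[OF t, of x] by (simp add: set_lebesgue_integral_def)
      finally show "(\<integral>s. ?f x s \<partial>lborel) = 1 / (x\<^sup>2 + t\<^sup>2)" using x by simp
    qed
  qed auto
  finally show "(LINT s:{0<..}|lborel. exp (- (s * t)) * (cosh s / sinh s - 1 / s)) =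
      2 * (\<integral>x. 1 / (x\<^sup>2 + t\<^sup>2) \<partial>bose_measure)" .
qed

lemma abs_exp_minus_diff_le:
  fixes a b c :: real
  assumes "c \<le> a" "c \<le> b"
  shows "\<bar>exp (- a) - exp (- b)\<bar> \<le> exp (- c) * \<bar>a - b\<bar>"
proof -
  have *: "\<bar>exp (- a) - exp (- b)\<bar> \<le> exp (- c) * \<bar>a - b\<bar>" if "c \<le> a" "a \<le> b" for a b :: real
  proof -
    have "exp (- a) - exp (- b) = exp (- a) * (1 - exp (- (b - a)))"
      by (simp add: algebra_simps flip: exp_add)
    also have "\<dots> \<le> exp (- c) * (b - a)"
      using that exp_ge_add_one_self[of "a - b"]
      by (intro mult_mono) (auto simp: algebra_simps)
    finally show ?thesis using that by simp
  qed
  show ?thesis using *[of a b] *[of b a] assms by (cases "a \<le> b") (auto simp: abs_minus_commute)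
qed

text \<open>
  Frullani's integral: as a function of \<open>u\<close> it has derivative \<open>1 / u\<close> and it vanishes at \<open>u = t\<close>.
\<close>

lemma
  fixes t u :: real
  assumes t: "t > 0" and u: "u \<ge> t"
  shows frullani_integrable: "set_integrable lborel {0<..} (\<lambda>s. (exp (- (s * t)) - exp (- (s * u))) / s)"
    and frullani_exp: "(LINT s:{0<..}|lborel. (exp (- (s * t)) - exp (- (s * u))) / s) = ln (u / t)"
proof -
  let ?f = "\<lambda>u s. indicator {0<..} s *\<^sub>R ((exp (- (s * t)) - exp (- (s * u))) / s)"
  let ?w = "\<lambda>s. indicator {0<..} s *\<^sub>R exp (- (s * (t / 2)))"
  have w: "integrable lborel ?w"
    using integrable_I0i_exp_mscale[of "t / 2"] t by (simp add: set_integrable_def)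
  have lip: "\<bar>?f u s - ?f v s\<bar> \<le> ?w s * \<bar>u - v\<bar>" if "u > t / 2" "v > t / 2" for u v s
  proof (cases "s > 0")
    case True
    have "\<bar>exp (- (s * v)) - exp (- (s * u))\<bar> \<le> exp (- (s * (t / 2))) * \<bar>s * v - s * u\<bar>"
      using that True by (intro abs_exp_minus_diff_le mult_left_mono) auto
    also have "\<bar>s * v - s * u\<bar> = s * \<bar>u - v\<bar>"
      using True by (simp add: abs_mult abs_minus_commute flip: right_diff_distrib)
    finally have "\<bar>(exp (- (s * v)) - exp (- (s * u))) / s\<bar> \<le> exp (- (s * (t / 2))) * \<bar>u - v\<bar>"
      using True by (simp add: divide_le_eq mult_ac)
    then show ?thesis using True by (simp flip: diff_divide_distrib)
  qed simp
  have int: "integrable lborel (?f u)" if "u > t / 2" for u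
  proof (rule Bochner_Integration.integrable_bound)
    show "integrable lborel (\<lambda>s. ?w s * \<bar>u - t\<bar>)" using w by simp
    show "AE s in lborel. norm (?f u s) \<le> norm (?w s * \<bar>u - t\<bar>)"
      using lip[OF that, of t] t by (auto simp: abs_mult)
  qed auto
  have D: "((\<lambda>u. \<integral>s. ?f u s \<partial>lborel) has_real_derivative 1 / u) (at u)" if u: "u > t / 2" for u
  proof -
    have "((\<lambda>u. \<integral>s. ?f u s \<partial>lborel) has_real_derivative
        (\<integral>s. indicator {0<..} s *\<^sub>R exp (- (s * u)) \<partial>lborel)) (at u)"
    proof (rule has_real_derivative_integral[of "{t / 2<..}", OF _ _ int _ _ lip w])
      have "((\<lambda>u. ?f u s) has_real_derivative indicator {0<..} s *\<^sub>R exp (- (s * u))) (at u)" for s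
        by (cases "s > 0") (auto intro!: derivative_eq_intros)
      then show "AE s in lborel.
          ((\<lambda>u. ?f u s) has_real_derivative indicator {0<..} s *\<^sub>R exp (- (s * u))) (at u)"
        by simp
    qed (use u in auto)
    also have "(\<integral>s. indicator {0<..} s *\<^sub>R exp (- (s * u)) \<partial>lborel) = 1 / u"
      using LBINT_I0i_exp_mscale[of u] u t
      by (simp add: interval_lebesgue_integral_0_infty set_lebesgue_integral_def)
    finally show ?thesis .
  qed
  have "(\<integral>s. ?f u s \<partial>lborel) - ln u = (\<integral>s. ?f t s \<partial>lborel) - ln t"
  proof (cases "t < u")
    case True
    show ?thesis
    proof (rule DERIV_isconst_end[OF True])
      have D': "((\<lambda>u. (\<integral>s. ?f u s \<partial>lborel) - ln u) has_real_derivative 0) (at x)" if "x \<ge> t" for x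
        using D[of x] that t by (auto intro!: derivative_eq_intros)
      show "continuous_on {t..u} (\<lambda>u. (\<integral>s. ?f u s \<partial>lborel) - ln u)"
        by (intro continuous_at_imp_continuous_on ballI DERIV_isCont[OF D']) auto
      show "((\<lambda>u. (\<integral>s. ?f u s \<partial>lborel) - ln u) has_real_derivative 0) (at x)" if "t < x" for x
        using D'[of x] that by simp
    qed
  qed (use u in simp)
  then show "(LINT s:{0<..}|lborel. (exp (- (s * t)) - exp (- (s * u))) / s) = ln (u / t)"
    using t u by (simp add: set_lebesgue_integral_def ln_div)
  show "set_integrable lborel {0<..} (\<lambda>s. (exp (- (s * t)) - exp (- (s * u))) / s)"
    using int[of u] t u by (simp add: set_integrable_def)
qed

text \<open>
  The difference equation satisfied by Binet's integral. In the Laplace picture the shift of \<open>t\<close> by \<open>2\<close>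
  multiplies the integrand by \<open>exp (- 2 * s)\<close>, and \<open>(1 - exp (- 2 * s)) * coth s = 1 + exp (- 2 * s)\<close>
  leaves only elementary integrals and a Frullani integral.
\<close>

lemma binet_step:
  fixes t :: real
  assumes t: "t > 0"
  shows "2 * (\<integral>x. 1 / (x\<^sup>2 + t\<^sup>2) \<partial>bose_measure) - 2 * (\<integral>x. 1 / (x\<^sup>2 + (t + 2)\<^sup>2) \<partial>bose_measure)
    = 1 / t + 1 / (t + 2) - ln ((t + 2) / t)"
proof -
  have t2: "t + 2 > 0" using t by simp
  let ?c = "\<lambda>s::real. cosh s / sinh s - 1 / s"
  have E: "set_integrable lborel {0<..} (\<lambda>s. exp (- (s * u)))"
      "(LINT s:{0<..}|lborel. exp (- (s * u))) = 1 / u" if "u > 0" for u :: real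
    using integrable_I0i_exp_mscale[OF that] LBINT_I0i_exp_mscale[OF that]
    by (simp_all add: interval_lebesgue_integral_0_infty)
  have pointwise: "exp (- (s * t)) * ?c s - exp (- (s * (t + 2))) * ?c s =
      (exp (- (s * t)) + exp (- (s * (t + 2)))) - (exp (- (s * t)) - exp (- (s * (t + 2)))) / s" if "s > 0" for s
  proof -
    define q where "q = exp (- (2 * s))"
    have "(1 - q) * cosh s = (1 + q) * sinh s"
      by (simp add: q_def cosh_field_def sinh_field_def algebra_simps flip: exp_add)
    then have q: "(1 - q) * (cosh s / sinh s) = 1 + q"
      using that by (simp add: field_simps)
    have eq: "exp (- (s * (t + 2))) = exp (- (s * t)) * q"
      by (simp add: q_def algebra_simps flip: exp_add)
    have "exp (- (s * t)) * ?c s - exp (- (s * (t + 2))) * ?c s =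
        exp (- (s * t)) * ((1 - q) * (cosh s / sinh s)) - (exp (- (s * t)) - exp (- (s * (t + 2)))) / s"
      unfolding eq by (simp add: algebra_simps diff_divide_distrib)
    also have "\<dots> = (exp (- (s * t)) + exp (- (s * (t + 2)))) - (exp (- (s * t)) - exp (- (s * (t + 2)))) / s"
      unfolding q eq by (simp add: distrib_left)
    finally show ?thesis .
  qed
  have "2 * (\<integral>x. 1 / (x\<^sup>2 + t\<^sup>2) \<partial>bose_measure) - 2 * (\<integral>x. 1 / (x\<^sup>2 + (t + 2)\<^sup>2) \<partial>bose_measure) =
      (LINT s:{0<..}|lborel. exp (- (s * t)) * ?c s - exp (- (s * (t + 2))) * ?c s)"
    unfolding integral_laplace_coth[OF t, symmetric] integral_laplace_coth[OF t2, symmetric]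
    using integrable_laplace_coth[OF t] integrable_laplace_coth[OF t2] by (simp add: set_integral_diff)
  also have "\<dots> = (LINT s:{0<..}|lborel. (exp (- (s * t)) + exp (- (s * (t + 2)))) -
      (exp (- (s * t)) - exp (- (s * (t + 2)))) / s)"
    by (rule set_lebesgue_integral_cong) (use pointwise in auto)
  also have "\<dots> = 1 / t + 1 / (t + 2) - ln ((t + 2) / t)"
    using E[OF t] E[OF t2] frullani_integrable[OF t, of "t + 2"] frullani_exp[OF t, of "t + 2"]
    by (simp add: set_integral_diff set_integral_add)
  finally show ?thesis .
qed

text \<open>
  By the recurrence of Digamma the right-hand side satisfies the same difference equation as the left-hand
  side, so their difference has period \<open>2\<close> in \<open>t\<close>. Both sides tend to \<open>0\<close> along \<open>t + 2 * n\<close>, hence the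
  difference is \<open>0\<close>.
\<close>

lemma binet_Digamma:
  fixes t :: real
  assumes t: "t > 0"
  shows "2 * (\<integral>x. 1 / (x\<^sup>2 + t\<^sup>2) \<partial>bose_measure) = ln (t / 2) - 1 / t - Digamma (t / 2)"
proof -
  define K where "K = (\<lambda>t::real. 2 * (\<integral>x. 1 / (x\<^sup>2 + t\<^sup>2) \<partial>bose_measure))"
  define R where "R = (\<lambda>t::real. ln (t / 2) - 1 / t - Digamma (t / 2))"
  let ?t = "\<lambda>n. t + 2 * real n"
  have step: "K u - R u = K (u + 2) - R (u + 2)" if "u > 0" for u
  proof -
    have "Digamma ((u + 2) / 2) = Digamma (u / 2) + 2 / u"
      using Digamma_plus1[of "u / 2"] that by (simp add: add_divide_distrib)
    then show ?thesis
      using binet_step[OF that] that by (simp add: K_def R_def ln_div)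
  qed
  have const: "K (?t n) - R (?t n) = K t - R t" for n
  proof (induction n)
    case (Suc n)
    then show ?case using step[of "?t n"] t by (simp add: algebra_simps)
  qed simp
  have "(\<lambda>n. K (?t n)) \<longlonglongrightarrow> 0"
  proof (rule Lim_null_comparison)
    let ?B = "2 * measure bose_measure UNIV"
    show "(\<lambda>n. ?B / (?t n)\<^sup>2) \<longlonglongrightarrow> 0"
      by real_asymp
    have "norm (K u) \<le> ?B / u\<^sup>2" if "u > 0" for u
    proof -
      have le: "1 / (x\<^sup>2 + u\<^sup>2) \<le> 1 / u\<^sup>2" for x
        using that by (intro divide_left_mono) (auto simp: add_nonneg_pos)
      have "(\<integral>x. 1 / (x\<^sup>2 + u\<^sup>2) \<partial>bose_measure) \<le> (\<integral>x. 1 / u\<^sup>2 \<partial>bose_measure)"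
        using le by (intro integral_mono integrable_bose_measure[where B = "1 / u\<^sup>2"]) auto
      then show ?thesis by (simp add: K_def integral_nonneg_AE)
    qed
    then show "\<forall>\<^sub>F n in sequentially. norm (K (?t n)) \<le> ?B / (?t n)\<^sup>2"
      using t by (auto intro!: always_eventually)
  qed
  moreover have "(\<lambda>n. R (?t n)) \<longlonglongrightarrow> 0"
  proof -
    have Dig: "Digamma (?t n / 2) = Digamma (t / 2) + (\<Sum>k<n. inverse (t / 2 + real k))" for n
    proof (induction n)
      case (Suc n)
      have "Digamma (?t (Suc n) / 2) = Digamma (?t n / 2) + 1 / (?t n / 2)"
        using Digamma_plus1[of "?t n / 2"] t by (simp add: add_divide_distrib add_ac)
      then show ?case using Suc by (simp add: add_divide_distrib inverse_eq_divide)
    qed simp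
    have "(\<lambda>n. ln (real n) - (\<Sum>k<n. inverse (t / 2 + real k))) \<longlonglongrightarrow> Digamma (t / 2)"
      using Digamma_LIMSEQ[of "t / 2"] t by simp
    moreover have "(\<lambda>n. ln (?t n / 2) - ln (real n) - 1 / ?t n) \<longlonglongrightarrow> 0"
      by real_asymp
    ultimately have "(\<lambda>n. (ln (real n) - (\<Sum>k<n. inverse (t / 2 + real k))) - Digamma (t / 2) +
        (ln (?t n / 2) - ln (real n) - 1 / ?t n)) \<longlonglongrightarrow> Digamma (t / 2) - Digamma (t / 2) + 0"
      by (intro tendsto_intros)
    then show ?thesis unfolding R_def Dig by (simp add: algebra_simps)
  qed
  ultimately have "(\<lambda>n. K (?t n) - R (?t n)) \<longlonglongrightarrow> 0 - 0" by (rule tendsto_diff)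
  then have "K t - R t = 0" unfolding const by (simp add: LIMSEQ_const_iff)
  then show ?thesis by (simp add: K_def R_def)
qed

section \<open>The exponential integral\<close>

text \<open>
  The entire part of Ei, that is, the sum of \<open>x ^ n / (n * n!)\<close> over \<open>n \<ge> 1\<close>. The term for \<open>n = 0\<close> is
  \<open>1 / 0 = 0\<close>.
\<close>

definition Ei_series :: "real \<Rightarrow> real" where
  "Ei_series x = (\<Sum>n. x ^ n / (real n * fact n))"

lemma Ei_series_0 [simp]: "Ei_series 0 = 0"
proof -
  have "(\<lambda>n. (0::real) ^ n / (real n * fact n)) = (\<lambda>n. 0)"
    by (auto simp: fun_eq_iff power_0_left)
  then show ?thesis by (simp add: Ei_series_def)
qed

lemma Ei_series_has_real_derivative_suminf:
  "(Ei_series has_real_derivative (\<Sum>n. x ^ n / fact (Suc n))) (at x)"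
proof -
  let ?c = "\<lambda>n. 1 / (real n * fact n)"
  have sum: "summable (\<lambda>n. ?c n * y ^ n)" for y :: real
  proof (rule summable_comparison_test')
    show "summable (\<lambda>n. \<bar>y\<bar> ^ n / fact n)"
      using summable_exp[of "\<bar>y\<bar>"] by (simp add: field_simps)
    show "norm (?c n * y ^ n) \<le> \<bar>y\<bar> ^ n / fact n" if "n \<ge> 0" for n
      using mult_right_mono[of 1 "real n" "\<bar>y\<bar> ^ n"]
      by (cases "n = 0") (auto simp: abs_mult power_abs field_simps)
  qed
  have "((\<lambda>x. \<Sum>n. ?c n * x ^ n) has_real_derivative (\<Sum>n. diffs ?c n * x ^ n)) (at x)"
    by (rule termdiffs_strong_converges_everywhere) (rule sum)
  moreover have "diffs ?c n * x ^ n = x ^ n / fact (Suc n)" for n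
    by (simp add: diffs_def del: fact_Suc of_nat_Suc)
  ultimately show ?thesis by (simp add: Ei_series_def [abs_def] del: fact_Suc)
qed

lemma isCont_Ei_series: "isCont Ei_series x"
  by (rule DERIV_isCont[OF Ei_series_has_real_derivative_suminf])

lemma DERIV_Ei_series:
  assumes "x \<noteq> 0"
  shows "(Ei_series has_real_derivative (exp x - 1) / x) (at x)"
proof -
  have "(\<lambda>n. x ^ n / fact n) sums exp x"
    using exp_converges[of x] by (simp add: field_simps)
  then have "(\<lambda>n. x ^ Suc n / fact (Suc n)) sums (exp x - 1)"
    by (subst sums_Suc_iff) simp
  from sums_divide[OF this, of x] have "(\<lambda>n. x ^ n / fact (Suc n)) sums ((exp x - 1) / x)"
    using assms by (simp del: fact_Suc)
  with Ei_series_has_real_derivative_suminf[of x] show ?thesis by (simp add: sums_iff)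
qed

definition Ei_primitive :: "real \<Rightarrow> real" where
  "Ei_primitive x = ln \<bar>x\<bar> + Ei_series x"

lemma DERIV_Ei_primitive:
  assumes "x \<noteq> 0"
  shows "(Ei_primitive has_real_derivative exp x / x) (at x)"
proof -
  have "((\<lambda>x. ln \<bar>x\<bar>) has_real_derivative 1 / x) (at x)"
  proof (cases "x > 0")
    case True
    have "((\<lambda>x. ln x) has_real_derivative 1 / x) (at x)" using True by (auto intro!: derivative_eq_intros)
    then show ?thesis
      by (rule has_field_derivative_transform_within_open[of _ _ _ "{0<..}"]) (use True in auto)
  next
    case False
    then have "((\<lambda>x. ln (- x)) has_real_derivative 1 / x) (at x)"
      using assms by (auto intro!: derivative_eq_intros)
    then show ?thesis
      by (rule has_field_derivative_transform_within_open[of _ _ _ "{..<0}"]) (use False assms in auto)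
  qed
  from DERIV_add[OF this DERIV_Ei_series[OF assms]] assms show ?thesis
    by (simp add: Ei_primitive_def [abs_def] field_simps)
qed

lemma integral_exp_over_id:
  fixes a b :: real
  assumes "a \<le> b" "a > 0 \<or> b < 0"
  shows "(LINT t:{a<..<b}|lborel. exp (- t) / t) = Ei_primitive (- b) - Ei_primitive (- a)"
proof -
  have "(LBINT t=ereal a..ereal b. exp (- t) / t) = Ei_primitive (- b) - Ei_primitive (- a)"
  proof (rule interval_integral_FTC_finite)
    show "continuous_on {min a b..max a b} (\<lambda>t. exp (- t) / t)"
      using assms by (intro continuous_intros) (auto simp: min_def max_def split: if_splits)
    fix t assume "min a b \<le> t" "t \<le> max a b"
    then have "t \<noteq> 0" using assms by auto
    then have "((\<lambda>t. Ei_primitive (- t)) has_real_derivative exp (- t) / t) (at t)"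
      using DERIV_chain2[OF DERIV_Ei_primitive[of "- t"] DERIV_minus[OF DERIV_ident]] by simp
    then show "((\<lambda>t. Ei_primitive (- t)) has_vector_derivative exp (- t) / t) (at t within {min a b..max a b})"
      by (rule has_vector_derivative_at_within[OF has_real_derivative_iff_has_vector_derivative[THEN iffD1]])
  qed
  then show ?thesis using assms by (simp add: interval_lebesgue_integral_def)
qed

lemma
  fixes s :: real
  assumes s: "s > 0"
  shows set_integrable_exp_over_id: "set_integrable lborel {s<..} (\<lambda>t. exp (- t) / t)"
    and Ei_minus_eq: "Ei (- s) = - (LINT t:{s<..}|lborel. exp (- t) / t)"
    and abs_Ei_minus_le: "\<bar>Ei (- s)\<bar> \<le> exp (- s) / s"
proof -
  note E = FTC_Ioi_nonneg[where F = "\<lambda>t. - exp (- t) / s" and f = "\<lambda>t. exp (- t) / s" and a = s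
      and A = "- exp (- s) / s" and B = 0]
  have lim: "((\<lambda>t. - exp (- t) / s) \<longlongrightarrow> 0) at_top" using s by real_asymp
  have dom: "set_integrable lborel {s<..} (\<lambda>t. exp (- t) / s)"
    using s by (intro E(1) lim) (auto intro!: derivative_eq_intros continuous_intros tendsto_eq_intros)
  have dom_val: "(LINT t:{s<..}|lborel. exp (- t) / s) = 0 - (- exp (- s) / s)"
    using s by (intro E(2) lim) (auto intro!: derivative_eq_intros continuous_intros tendsto_eq_intros)
  have le: "exp (- t) / t \<le> exp (- t) / s" if "t > s" for t
    using that s by (intro divide_left_mono) auto
  show int: "set_integrable lborel {s<..} (\<lambda>t. exp (- t) / t)"
    by (rule set_integrable_bound[OF dom]) (use s le in \<open>auto simp: set_borel_measurable_def\<close>)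
  show eq: "Ei (- s) = - (LINT t:{s<..}|lborel. exp (- t) / t)"
    using s by (simp add: Ei_def)
  have "(LINT t:{s<..}|lborel. exp (- t) / t) \<le> (LINT t:{s<..}|lborel. exp (- t) / s)"
    by (rule set_integral_mono[OF int dom]) (use le in auto)
  moreover have "(LINT t:{s<..}|lborel. exp (- t) / t) \<ge> 0"
    unfolding set_lebesgue_integral_def
    by (rule integral_nonneg_AE) (use s in \<open>auto simp: indicator_def\<close>)
  ultimately show "\<bar>Ei (- s)\<bar> \<le> exp (- s) / s"
    unfolding eq using dom_val s by simp
qed

lemma Ei_minus_tendsto_0: "((\<lambda>s. Ei (- s)) \<longlongrightarrow> 0) at_top"
proof (rule Lim_null_comparison)
  show "\<forall>\<^sub>F s in at_top. norm (Ei (- s)) \<le> exp (- s) / s"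
    using eventually_gt_at_top[of 0] by eventually_elim (use abs_Ei_minus_le in auto)
  show "((\<lambda>s::real. exp (- s) / s) \<longlongrightarrow> 0) at_top" by real_asymp
qed

text \<open>
  On the negative half-line Ei and \<open>Ei_primitive\<close> are primitives of the same function, so they differ by
  a constant.
\<close>

lemma Ei_minus_diff:
  fixes s u :: real
  assumes "0 < s" "s \<le> u"
  shows "Ei (- u) - Ei (- s) = Ei_primitive (- u) - Ei_primitive (- s)"
proof -
  let ?f = "\<lambda>t::real. exp (- t) / t"
  have E: "einterval (ereal a) \<infinity> = {a<..}" for a by (auto simp: einterval_def)
  have "(LBINT t=ereal s..ereal u. ?f t) + (LBINT t=ereal u..\<infinity>. ?f t) = (LBINT t=ereal s..\<infinity>. ?f t)"
    by (rule interval_integral_sum)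
      (use assms set_integrable_exp_over_id[of s] in
        \<open>simp add: interval_lebesgue_integrable_def E min_def max_def\<close>)
  then have "(LINT t:{s<..<u}|lborel. ?f t) + (LINT t:{u<..}|lborel. ?f t) = (LINT t:{s<..}|lborel. ?f t)"
    using assms by (simp add: interval_lebesgue_integral_def E)
  then show ?thesis
    using assms integral_exp_over_id[of s u] by (simp add: Ei_minus_eq)
qed

text \<open>
  The constant \<open>C\<close> is found by evaluating Binet's integral at \<open>t = 2\<close> in two ways. Binet's formula gives
  \<open>\<gamma> - 1/2\<close> because \<open>Digamma 1 = - \<gamma>\<close>. On the other hand, the Laplace integrand
  \<open>exp (- 2 * s) * (coth s - 1 / s)\<close> has a primitive made of elementary functions and
  \<open>Ei_primitive (- 2 * s)\<close>, which leads to \<open>C - 1/2\<close>.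
\<close>

lemma Ei_minus:
  fixes s :: real
  assumes s: "s > 0"
  shows "Ei (- s) = euler_mascheroni + Ei_primitive (- s)"
proof -
  define C where "C = Ei (- 1) - Ei_primitive (- 1)"
  have Ei_C: "Ei (- s) = C + Ei_primitive (- s)" if "s > 0" for s
    using Ei_minus_diff[of s 1] Ei_minus_diff[of 1 s] that unfolding C_def by (cases "s \<le> 1") auto
  let ?F = "\<lambda>s. exp (- (s * 2)) / 2 + ln (1 - exp (- (s * 2))) - Ei_primitive (- (s * 2))"
  have "(LINT s:{0<..}|lborel. exp (- (s * 2)) * (cosh s / sinh s - 1 / s)) = C - 1 / 2"
  proof (rule FTC_Ioi_integrable)
    show "set_integrable lborel {0<..} (\<lambda>s::real. exp (- (s * 2)) * (cosh s / sinh s - 1 / s))"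
      by (rule integrable_laplace_coth) simp
    show "isCont (\<lambda>s. exp (- (s * 2)) * (cosh s / sinh s - 1 / s)) s" if "s > 0" for s :: real
      using that by (auto intro!: continuous_intros)
    show "(?F has_real_derivative exp (- (s * 2)) * (cosh s / sinh s - 1 / s)) (at s)" if s: "s > 0" for s
    proof -
      define q where "q = exp (- (s * 2))"
      have q: "q < 1" using s by (simp add: q_def)
      have "(1 - q) * cosh s = (1 + q) * sinh s"
        by (simp add: q_def cosh_field_def sinh_field_def algebra_simps flip: exp_add)
      then have coth: "cosh s / sinh s = (1 + q) / (1 - q)"
        using s q by (simp add: field_simps)
      have "((\<lambda>s. Ei_primitive (- (s * 2))) has_real_derivative
          exp (- (s * 2)) / (- (s * 2)) * - 2) (at s)"
        by (rule DERIV_chain2[where f = Ei_primitive and g = "\<lambda>s. - (s * 2)", OF DERIV_Ei_primitive])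
          (use s in \<open>auto intro!: derivative_eq_intros\<close>)
      then have P: "((\<lambda>s. Ei_primitive (- (s * 2))) has_real_derivative q / s) (at s)"
        by (simp add: q_def)
      have "(?F has_real_derivative - q + 2 * q / (1 - q) - q / s) (at s)"
        using q by (auto intro!: derivative_eq_intros P simp: q_def)
      also have "- q + 2 * q / (1 - q) - q / s = exp (- (s * 2)) * (cosh s / sinh s - 1 / s)"
        unfolding coth q_def[symmetric] using s q by (simp add: field_simps)
      finally show ?thesis .
    qed
    \<comment> \<open>The two logarithmic singularities of the primitive at \<open>0\<close> cancel.\<close>
    have "((\<lambda>s. exp (- (s * 2)) / 2 + ln ((1 - exp (- (s * 2))) / (s * 2)) - Ei_series (- (s * 2)))
        \<longlongrightarrow> 1 / 2 + 0 - Ei_series 0) (at_right 0)"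
    proof (intro tendsto_add tendsto_diff)
      show "((\<lambda>s::real. exp (- (s * 2)) / 2) \<longlongrightarrow> 1 / 2) (at_right 0)" by real_asymp
      show "((\<lambda>s::real. ln ((1 - exp (- (s * 2))) / (s * 2))) \<longlongrightarrow> 0) (at_right 0)" by real_asymp
      show "((\<lambda>s. Ei_series (- (s * 2))) \<longlongrightarrow> Ei_series 0) (at_right 0)"
        by (rule isCont_tendsto_compose[OF isCont_Ei_series]) (auto intro!: tendsto_eq_intros)
    qed
    then show "(?F \<longlongrightarrow> 1 / 2) (at_right 0)"
    proof (rule filterlim_mono_eventually)
      show "\<forall>\<^sub>F s in at_right 0. exp (- (s * 2)) / 2 + ln ((1 - exp (- (s * 2))) / (s * 2)) -
          Ei_series (- (s * 2)) = ?F s"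
        using eventually_at_right_less[of 0]
        by eventually_elim (simp add: Ei_primitive_def ln_div ln_mult)
    qed auto
    \<comment> \<open>At infinity Ei vanishes, so \<open>Ei_primitive\<close> tends to \<open>- C\<close>.\<close>
    have lim: "((\<lambda>s. Ei (- (s * 2))) \<longlongrightarrow> 0) at_top"
      by (rule filterlim_compose[OF Ei_minus_tendsto_0]) real_asymp
    have "((\<lambda>s. exp (- (s * 2)) / 2 + ln (1 - exp (- (s * 2))) - (Ei (- (s * 2)) - C))
        \<longlongrightarrow> 0 + 0 - (0 - C)) at_top"
      by (intro tendsto_add tendsto_diff lim tendsto_const; real_asymp)
    then show "(?F \<longlongrightarrow> C) at_top"
    proof (rule filterlim_mono_eventually)
      show "\<forall>\<^sub>F s in at_top. exp (- (s * 2)) / 2 + ln (1 - exp (- (s * 2))) - (Ei (- (s * 2)) - C) = ?F s"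
        using eventually_gt_at_top[of 0] by eventually_elim (simp add: Ei_C)
    qed auto
  qed
  moreover have "(LINT s:{0<..}|lborel. exp (- (s * 2)) * (cosh s / sinh s - 1 / s)) = (euler_mascheroni - 1 / 2 :: real)"
    using integral_laplace_coth[of 2] binet_Digamma[of 2] by simp
  ultimately have "C = euler_mascheroni" by simp
  with Ei_C[OF s] show ?thesis by simp
qed

text \<open>
  For positive arguments the two integrals of the principal value contribute
  \<open>Ei_primitive \<epsilon> - Ei_primitive x\<close> and \<open>- \<gamma> - Ei_primitive (- \<epsilon>)\<close>; the logarithms of \<open>\<epsilon>\<close> cancel in the sum.
\<close>

lemma Ei_eq:
  assumes "x \<noteq> 0"
  shows "Ei x = euler_mascheroni + Ei_primitive x"
proof (cases "x < 0")
  case True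
  then show ?thesis using Ei_minus[of "- x"] by simp
next
  case False
  with assms have x: "x > 0" by simp
  have "((\<lambda>\<epsilon>. Ei_series \<epsilon> - Ei_series (- \<epsilon>) - Ei_primitive x - euler_mascheroni)
      \<longlongrightarrow> Ei_series 0 - Ei_series 0 - Ei_primitive x - euler_mascheroni) (at_right 0)"
    by (intro tendsto_diff tendsto_const isCont_tendsto_compose[OF isCont_Ei_series])
      (auto intro!: tendsto_eq_intros)
  then have "((\<lambda>\<epsilon>. (LINT t:{-x<..< -\<epsilon>}|lborel. exp (- t) / t) + (LINT t:{\<epsilon><..}|lborel. exp (- t) / t))
      \<longlongrightarrow> - Ei_primitive x - euler_mascheroni) (at_right 0)"
  proof (rule filterlim_mono_eventually)
    have "\<forall>\<^sub>F \<epsilon> in at_right 0. \<epsilon> < x" using x by (intro eventually_at_rightI[of 0 x]) auto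
    then show "\<forall>\<^sub>F \<epsilon> in at_right 0. Ei_series \<epsilon> - Ei_series (- \<epsilon>) - Ei_primitive x - euler_mascheroni =
        (LINT t:{-x<..< -\<epsilon>}|lborel. exp (- t) / t) + (LINT t:{\<epsilon><..}|lborel. exp (- t) / t)"
      using eventually_at_right_less[of 0]
    proof eventually_elim
      fix \<epsilon> :: real assume e: "\<epsilon> < x" "0 < \<epsilon>"
      have "(LINT t:{\<epsilon><..}|lborel. exp (- t) / t) = - (euler_mascheroni + Ei_primitive (- \<epsilon>))"
        using Ei_minus_eq[OF e(2)] Ei_minus[OF e(2)] by simp
      moreover have "(LINT t:{-x<..< -\<epsilon>}|lborel. exp (- t) / t) = Ei_primitive \<epsilon> - Ei_primitive x"
        using integral_exp_over_id[of "- x" "- \<epsilon>"] e by simp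
      ultimately show "Ei_series \<epsilon> - Ei_series (- \<epsilon>) - Ei_primitive x - euler_mascheroni =
          (LINT t:{-x<..< -\<epsilon>}|lborel. exp (- t) / t) + (LINT t:{\<epsilon><..}|lborel. exp (- t) / t)"
        by (simp add: Ei_primitive_def)
    qed
  qed auto
  from tendsto_Lim[OF _ this] False show ?thesis by (simp add: Ei_def)
qed

lemma DERIV_Ei:
  assumes "x \<noteq> 0"
  shows "(Ei has_real_derivative exp x / x) (at x)"
proof -
  have "((\<lambda>x. euler_mascheroni + Ei_primitive x) has_real_derivative exp x / x) (at x)"
    using DERIV_Ei_primitive[OF assms] by (auto intro!: derivative_eq_intros)
  then show ?thesis
    by (rule has_field_derivative_transform_within_open[of _ _ _ "- {0}"])
      (use assms in \<open>auto simp: Ei_eq\<close>)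
qed

section \<open>Closed form of the cosine transform\<close>

lemma abs_sin_diff_le: "\<bar>sin a - sin b\<bar> \<le> \<bar>a - b\<bar>" for a b :: real
  using field_differentiable_bound[of UNIV sin cos 1 a b] by (simp add: DERIV_sin)

lemma abs_cos_diff_le: "\<bar>cos a - cos b\<bar> \<le> \<bar>a - b\<bar>" for a b :: real
  using field_differentiable_bound[of UNIV cos "\<lambda>x. - sin x" 1 a b] by (simp add: DERIV_cos)

text \<open>
  The cosine transform in question and its antiderivative. Taken together they satisfy a first-order
  linear system, so no second derivatives are needed.
\<close>

definition bose_cos :: "real \<Rightarrow> real" where
  "bose_cos s = 2 * (\<integral>x. cos (s * x) / (1 + x\<^sup>2) \<partial>bose_measure)"

definition bose_sin :: "real \<Rightarrow> real" where
  "bose_sin s = 2 * (\<integral>x. sin (s * x) / (x * (1 + x\<^sup>2)) \<partial>bose_measure)"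

lemma abs_sin_mult_div_le: "\<bar>sin (s * x) / x\<bar> \<le> \<bar>s\<bar>" for s x :: real
  using abs_sin_x_le_abs_x[of "s * x"] by (cases "x = 0") (auto simp: abs_mult divide_le_eq)

lemma div_1_plus_square_le:
  fixes a c x :: real
  assumes "\<bar>a\<bar> \<le> c"
  shows "\<bar>a / (1 + x\<^sup>2)\<bar> \<le> c"
proof -
  have "\<bar>a\<bar> \<le> c * (1 + x\<^sup>2)"
    using assms mult_left_mono[of 1 "1 + x\<^sup>2" c] abs_ge_zero[of a] by fastforce
  moreover have "1 + x\<^sup>2 > 0" by (simp add: add_pos_nonneg)
  ultimately show ?thesis by (simp add: divide_le_eq)
qed

lemma integrable_bose_cos: "integrable bose_measure (\<lambda>x. cos (s * x) / (1 + x\<^sup>2))"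
  by (rule integrable_bose_measure[where B = 1, OF _ div_1_plus_square_le]) auto

lemma integrable_bose_sin: "integrable bose_measure (\<lambda>x. sin (s * x) / (x * (1 + x\<^sup>2)))"
proof (rule integrable_bose_measure[where B = "\<bar>s\<bar>"])
  show "\<bar>sin (s * x) / (x * (1 + x\<^sup>2))\<bar> \<le> \<bar>s\<bar>" for x
    using div_1_plus_square_le[OF abs_sin_mult_div_le[of s x], of x] by simp
qed auto

lemma integrable_sin_over_id_bose: "integrable bose_measure (\<lambda>x. sin (s * x) / x)"
  by (rule integrable_bose_measure[where B = "\<bar>s\<bar>"]) (use abs_sin_mult_div_le in auto)

text \<open>
  Here \<open>- x / (1 + x\<^sup>2) = 1 / (x * (1 + x\<^sup>2)) - 1 / x\<close>, so the derivative is a combination of \<open>bose_sin\<close>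
  and the sine transform with the known value \<open>coth s - 1 / s\<close>.
\<close>

lemma DERIV_bose_cos:
  "(bose_cos has_real_derivative bose_sin s - 2 * (\<integral>x. sin (s * x) / x \<partial>bose_measure)) (at s)"
proof -
  let ?f' = "\<lambda>x. - x * sin (s * x) / (1 + x\<^sup>2)"
  have id_le: "\<bar>x\<bar> / (1 + x\<^sup>2) \<le> 1" for x :: real
  proof -
    have "\<bar>x\<bar> \<le> 1 + x\<^sup>2"
      using zero_le_power2[of "\<bar>x\<bar> - 1 / 2"] by (simp add: power2_eq_square algebra_simps)
    moreover have "1 + x\<^sup>2 > 0" by (simp add: add_pos_nonneg)
    ultimately show ?thesis by (simp add: divide_le_eq)
  qed
  have D: "((\<lambda>u. \<integral>x. cos (u * x) / (1 + x\<^sup>2) \<partial>bose_measure) has_real_derivative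
      (\<integral>x. ?f' x \<partial>bose_measure)) (at s)"
  proof (rule has_real_derivative_integral[where U = UNIV and w = "\<lambda>_. 1"])
    show "\<bar>cos (u * x) / (1 + x\<^sup>2) - cos (s * x) / (1 + x\<^sup>2)\<bar> \<le> 1 * \<bar>u - s\<bar>" for u x
    proof -
      have "\<bar>cos (u * x) / (1 + x\<^sup>2) - cos (s * x) / (1 + x\<^sup>2)\<bar> = \<bar>cos (u * x) - cos (s * x)\<bar> / (1 + x\<^sup>2)"
        by (simp add: abs_divide flip: diff_divide_distrib)
      also have "\<dots> \<le> \<bar>u * x - s * x\<bar> / (1 + x\<^sup>2)"
        by (intro divide_right_mono abs_cos_diff_le) auto
      also have "\<dots> = \<bar>u - s\<bar> * (\<bar>x\<bar> / (1 + x\<^sup>2))"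
        by (simp add: abs_mult flip: left_diff_distrib)
      also have "\<dots> \<le> \<bar>u - s\<bar> * 1"
        by (intro mult_left_mono id_le) auto
      finally show ?thesis by simp
    qed
    have "((\<lambda>u. cos (u * x) / (1 + x\<^sup>2)) has_real_derivative ?f' x) (at s)" for x
      by (rule DERIV_cdivide) (auto intro!: derivative_eq_intros)
    then show "AE x in bose_measure. ((\<lambda>u. cos (u * x) / (1 + x\<^sup>2)) has_real_derivative ?f' x) (at s)"
      by simp
  qed (auto simp: integrable_bose_cos)
  have "?f' x = sin (s * x) / (x * (1 + x\<^sup>2)) - sin (s * x) / x" for x
  proof (cases "x = 0")
    case False
    have "1 + x\<^sup>2 > 0" by (simp add: add_pos_nonneg)
    then have "sin (s * x) / (x * (1 + x\<^sup>2)) - sin (s * x) / x =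
        (sin (s * x) - sin (s * x) * (1 + x\<^sup>2)) / (x * (1 + x\<^sup>2))"
      by (simp add: diff_divide_distrib)
    also have "sin (s * x) - sin (s * x) * (1 + x\<^sup>2) = x * (- x * sin (s * x))"
      by (simp add: algebra_simps power2_eq_square)
    finally show ?thesis using False by simp
  qed simp
  then have eq: "(\<integral>x. ?f' x \<partial>bose_measure) =
      (\<integral>x. sin (s * x) / (x * (1 + x\<^sup>2)) \<partial>bose_measure) - (\<integral>x. sin (s * x) / x \<partial>bose_measure)"
    using integrable_bose_sin integrable_sin_over_id_bose by simp
  from DERIV_cmult[OF D[unfolded eq], of 2] show ?thesis
    by (simp add: bose_cos_def [abs_def] bose_sin_def right_diff_distrib)
qed

lemma DERIV_bose_sin: "(bose_sin has_real_derivative bose_cos s) (at s)"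
proof -
  have "((\<lambda>u. \<integral>x. sin (u * x) / (x * (1 + x\<^sup>2)) \<partial>bose_measure) has_real_derivative
      (\<integral>x. cos (s * x) / (1 + x\<^sup>2) \<partial>bose_measure)) (at s)"
  proof (rule has_real_derivative_integral[where U = UNIV and w = "\<lambda>_. 1"])
    show "\<bar>sin (u * x) / (x * (1 + x\<^sup>2)) - sin (s * x) / (x * (1 + x\<^sup>2))\<bar> \<le> 1 * \<bar>u - s\<bar>" for u x
    proof (cases "x = 0")
      case False
      have "\<bar>sin (u * x) - sin (s * x)\<bar> \<le> \<bar>u * x - s * x\<bar>" by (rule abs_sin_diff_le)
      also have "\<dots> = \<bar>u - s\<bar> * \<bar>x\<bar>" by (simp add: abs_mult flip: left_diff_distrib)
      finally have "\<bar>(sin (u * x) - sin (s * x)) / x\<bar> \<le> \<bar>u - s\<bar>"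
        using False by (simp add: divide_le_eq)
      from div_1_plus_square_le[OF this, of x] show ?thesis
        by (simp add: diff_divide_distrib)
    qed simp
    show "AE x in bose_measure.
        ((\<lambda>u. sin (u * x) / (x * (1 + x\<^sup>2))) has_real_derivative cos (s * x) / (1 + x\<^sup>2)) (at s)"
      using AE_bose_measure_pos
    proof eventually_elim
      fix x :: real assume "x > 0"
      have "((\<lambda>u. sin (u * x) / (x * (1 + x\<^sup>2))) has_real_derivative
          cos (s * x) * x / (x * (1 + x\<^sup>2))) (at s)"
        by (rule DERIV_cdivide) (auto intro!: derivative_eq_intros)
      then show "((\<lambda>u. sin (u * x) / (x * (1 + x\<^sup>2))) has_real_derivative cos (s * x) / (1 + x\<^sup>2)) (at s)"
        using \<open>x > 0\<close> by simp
    qed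
  qed (auto simp: integrable_bose_sin)
  from DERIV_cmult[OF this, of 2] show ?thesis
    by (simp add: bose_cos_def bose_sin_def [abs_def])
qed

text \<open>
  The growth is at most linear, which excludes a component along \<open>exp s\<close>.
\<close>

lemma bounded_bose_cos_plus_sin:
  assumes "s \<ge> 1"
  shows "\<bar>bose_cos s + bose_sin s\<bar> \<le> 2 * ((1 + s) * measure bose_measure UNIV)"
proof -
  have bd: "\<bar>cos (s * x) / (1 + x\<^sup>2) + sin (s * x) / (x * (1 + x\<^sup>2))\<bar> \<le> 1 + s" for x
  proof -
    have "\<bar>cos (s * x) / (1 + x\<^sup>2)\<bar> \<le> 1" by (intro div_1_plus_square_le) simp
    moreover have "\<bar>sin (s * x) / (x * (1 + x\<^sup>2))\<bar> \<le> \<bar>s\<bar>"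
      using div_1_plus_square_le[OF abs_sin_mult_div_le[of s x], of x] by simp
    ultimately show ?thesis using assms by linarith
  qed
  have "\<bar>\<integral>x. cos (s * x) / (1 + x\<^sup>2) + sin (s * x) / (x * (1 + x\<^sup>2)) \<partial>bose_measure\<bar>
      \<le> (\<integral>x. \<bar>cos (s * x) / (1 + x\<^sup>2) + sin (s * x) / (x * (1 + x\<^sup>2))\<bar> \<partial>bose_measure)"
    by (rule integral_abs_bound)
  also have "\<dots> \<le> (\<integral>x. 1 + s \<partial>bose_measure)"
    by (rule integral_mono[OF _ _ bd])
      (intro integrable_abs Bochner_Integration.integrable_add integrable_bose_cos integrable_bose_sin
        bose.integrable_const)+
  finally have "\<bar>\<integral>x. cos (s * x) / (1 + x\<^sup>2) + sin (s * x) / (x * (1 + x\<^sup>2)) \<partial>bose_measure\<bar>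
      \<le> (\<integral>x. 1 + s \<partial>bose_measure)" .
  moreover have "bose_cos s + bose_sin s =
      2 * (\<integral>x. cos (s * x) / (1 + x\<^sup>2) + sin (s * x) / (x * (1 + x\<^sup>2)) \<partial>bose_measure)"
    using integrable_bose_cos integrable_bose_sin by (simp add: bose_cos_def bose_sin_def)
  ultimately show ?thesis by (simp add: abs_mult mult.commute)
qed

lemma bose_cos_0: "bose_cos 0 = euler_mascheroni + ln 2 - 1"
proof -
  have "bose_cos 0 = ln (1 / 2) - 1 - Digamma (1 / 2)"
    using binet_Digamma[of 1] by (simp add: bose_cos_def add.commute)
  then show ?thesis by (simp add: Digamma_one_half ln_div)
qed

definition ln_coth_half :: "real \<Rightarrow> real" where
  "ln_coth_half s = ln (1 + exp (- s)) - ln (1 - exp (- s))"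

lemma DERIV_ln_coth_half:
  assumes "s > 0"
  shows "(ln_coth_half has_real_derivative - 1 / sinh s) (at s)"
proof -
  define q where "q = exp (- s)"
  have q: "0 < q" "q < 1" using assms by (simp_all add: q_def)
  have "(ln_coth_half has_real_derivative - q / (1 + q) - q / (1 - q)) (at s)"
    unfolding ln_coth_half_def [abs_def]
    using q by (auto intro!: derivative_eq_intros simp: q_def add_pos_pos)
  moreover have "- q / (1 + q) - q / (1 - q) = - 1 / sinh s"
  proof -
    have "sinh s = (1 / q - q) / 2"
      by (simp add: sinh_field_def q_def exp_minus field_simps)
    then have sinh: "sinh s = (1 - q) * (1 + q) / (2 * q)" using q by (simp add: field_simps)
    show ?thesis unfolding sinh using q by (simp add: field_simps)
  qed
  ultimately show ?thesis by simp
qed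

lemma cosh_over_sinh:
  fixes s :: real
  assumes "s > 0"
  shows "exp s / sinh s = cosh s / sinh s + 1" "exp (- s) / sinh s = cosh s / sinh s - 1"
  using assms by (simp_all add: field_simps cosh_plus_sinh cosh_minus_sinh add_divide_distrib[symmetric])

text \<open>
  With \<open>a s = coth s - 1 / s\<close>, both sides solve \<open>u' = u - a\<close>, so their difference is a multiple of
  \<open>exp s\<close>. Since both sides are \<open>o(exp s)\<close> at infinity, the multiple is \<open>0\<close>.
\<close>

lemma bose_cos_plus_sin:
  assumes s: "s > 0"
  shows "bose_cos s + bose_sin s = - 1 + exp s * (ln_coth_half s + Ei (- s))"
proof -
  let ?D = "\<lambda>s. exp (- s) * (bose_cos s + bose_sin s - (- 1 + exp s * (ln_coth_half s + Ei (- s))))"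
  have D: "(?D has_real_derivative 0) (at s)" if s: "s > 0" for s
  proof -
    let ?a = "cosh s / sinh s - 1 / s"
    have U: "((\<lambda>s. bose_cos s + bose_sin s) has_real_derivative bose_cos s + bose_sin s - ?a) (at s)"
      using DERIV_add[OF DERIV_bose_cos DERIV_bose_sin, of s] unfolding integral_sin_bose[OF s]
      by (simp add: algebra_simps)
    have "((\<lambda>s. Ei (- s)) has_real_derivative exp (- s) / (- s) * - 1) (at s)"
      by (rule DERIV_chain2[where f = Ei and g = uminus, OF DERIV_Ei])
        (use s in \<open>auto intro!: derivative_eq_intros\<close>)
    then have E: "((\<lambda>s. Ei (- s)) has_real_derivative exp (- s) / s) (at s)" by simp
    have "((\<lambda>s. - 1 + exp s * (ln_coth_half s + Ei (- s))) has_real_derivative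
        exp s * (ln_coth_half s + Ei (- s)) + exp s * (- 1 / sinh s + exp (- s) / s)) (at s)"
      using s by (auto intro!: derivative_eq_intros DERIV_ln_coth_half E)
    also have "exp s * (- 1 / sinh s + exp (- s) / s) = - (exp s / sinh s) + 1 / s"
      by (simp add: algebra_simps flip: exp_add)
    also have "\<dots> = - 1 - ?a" unfolding cosh_over_sinh[OF s] by simp
    finally have P: "((\<lambda>s. - 1 + exp s * (ln_coth_half s + Ei (- s))) has_real_derivative
        exp s * (ln_coth_half s + Ei (- s)) + (- 1 - ?a)) (at s)" .
    have X: "((\<lambda>s. exp (- s)) has_real_derivative - exp (- s)) (at s)" for s :: real
      by (auto intro!: derivative_eq_intros)
    from DERIV_mult[OF X DERIV_diff[OF U P]] show ?thesis
      by (simp add: algebra_simps)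
  qed
  have "\<exists>c. \<forall>s\<in>{0<..}. ?D s = c"
    by (rule has_field_derivative_zero_constant) (use D in \<open>auto intro: has_field_derivative_at_within\<close>)
  then obtain c where c: "\<And>s. s > 0 \<Longrightarrow> ?D s = c" by auto
  have "((\<lambda>s. exp (- s) * (bose_cos s + bose_sin s) + exp (- s) - ln_coth_half s - Ei (- s))
      \<longlongrightarrow> 0 + 0 - 0 - 0) at_top"
  proof (intro tendsto_add tendsto_diff Ei_minus_tendsto_0)
    show "((\<lambda>s. exp (- s) * (bose_cos s + bose_sin s)) \<longlongrightarrow> 0) at_top"
    proof (rule Lim_null_comparison)
      let ?B = "\<lambda>s. exp (- s) * (2 * ((1 + s) * measure bose_measure UNIV))"
      show "\<forall>\<^sub>F s in at_top. norm (exp (- s) * (bose_cos s + bose_sin s)) \<le> ?B s"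
        using eventually_ge_at_top[of 1]
        by eventually_elim (use bounded_bose_cos_plus_sin in \<open>auto simp: abs_mult\<close>)
      show "(?B \<longlongrightarrow> 0) at_top" by real_asymp
    qed
    show "((\<lambda>s::real. exp (- s)) \<longlongrightarrow> 0) at_top" by real_asymp
    show "(ln_coth_half \<longlongrightarrow> 0) at_top" unfolding ln_coth_half_def [abs_def] by real_asymp
  qed
  also have "0 + 0 - 0 - 0 = (0 :: real)" by simp
  finally have "((\<lambda>s::real. c) \<longlongrightarrow> 0) at_top"
  proof (rule filterlim_mono_eventually)
    show "\<forall>\<^sub>F s in at_top. exp (- s) * (bose_cos s + bose_sin s) + exp (- s) - ln_coth_half s - Ei (- s) = c"
      using eventually_gt_at_top[of 0]
      by eventually_elim (use c in \<open>simp add: algebra_simps flip: exp_add\<close>)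
  qed auto
  then have "c = 0" by (simp add: tendsto_const_iff)
  with c[OF s] show ?thesis by simp
qed

text \<open>
  Both sides solve \<open>u' = - u - a\<close>, again with \<open>a s = coth s - 1 / s\<close>, so their difference is a multiple
  of \<open>exp (- s)\<close>. The multiple is \<open>0\<close> because both sides have the limit \<open>\<gamma> + ln 2 - 1\<close> at \<open>0\<close>: for
  the integrals this is Binet's formula at \<open>t = 1\<close>, for the closed form the logarithm in Ei cancels the
  one in \<open>ln_coth_half\<close>.
\<close>

lemma bose_cos_minus_sin:
  assumes s: "s > 0"
  shows "bose_cos s - bose_sin s = - 1 + exp (- s) * (ln_coth_half s + Ei s)"
proof -
  let ?D = "\<lambda>s. exp s * (bose_cos s - bose_sin s - (- 1 + exp (- s) * (ln_coth_half s + Ei s)))"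
  have D: "(?D has_real_derivative 0) (at s)" if s: "s > 0" for s
  proof -
    let ?a = "cosh s / sinh s - 1 / s"
    have U: "((\<lambda>s. bose_cos s - bose_sin s) has_real_derivative - (bose_cos s - bose_sin s) - ?a) (at s)"
      using DERIV_diff[OF DERIV_bose_cos DERIV_bose_sin, of s] unfolding integral_sin_bose[OF s]
      by (simp add: algebra_simps)
    have "((\<lambda>s. - 1 + exp (- s) * (ln_coth_half s + Ei s)) has_real_derivative
        - exp (- s) * (ln_coth_half s + Ei s) + exp (- s) * (- 1 / sinh s + exp s / s)) (at s)"
      using s by (auto intro!: derivative_eq_intros DERIV_ln_coth_half DERIV_Ei)
    also have "exp (- s) * (- 1 / sinh s + exp s / s) = - (exp (- s) / sinh s) + 1 / s"
      by (simp add: algebra_simps flip: exp_add)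
    also have "\<dots> = 1 - ?a" unfolding cosh_over_sinh[OF s] by simp
    finally have P: "((\<lambda>s. - 1 + exp (- s) * (ln_coth_half s + Ei s)) has_real_derivative
        - exp (- s) * (ln_coth_half s + Ei s) + (1 - ?a)) (at s)" .
    from DERIV_mult[OF DERIV_exp DERIV_diff[OF U P]] show ?thesis
      by (simp add: algebra_simps)
  qed
  have "\<exists>c. \<forall>s\<in>{0<..}. ?D s = c"
    by (rule has_field_derivative_zero_constant) (use D in \<open>auto intro: has_field_derivative_at_within\<close>)
  then obtain c where c: "\<And>s. s > 0 \<Longrightarrow> ?D s = c" by auto
  have bc: "((\<lambda>s. bose_cos s - bose_sin s) \<longlongrightarrow> bose_cos 0 - bose_sin 0) (at_right 0)"
    using DERIV_isCont[OF DERIV_diff[OF DERIV_bose_cos DERIV_bose_sin], of 0]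
    by (auto simp: isCont_def intro: filterlim_mono at_le)
  have Ein: "(Ei_series \<longlongrightarrow> Ei_series 0) (at_right 0)"
    using isCont_Ei_series[of 0] by (auto simp: isCont_def intro: filterlim_mono at_le)
  have "((\<lambda>s. exp s * (bose_cos s - bose_sin s) + exp s -
      (ln (1 + exp (- s)) - ln ((1 - exp (- s)) / s) + (euler_mascheroni + Ei_series s)))
      \<longlongrightarrow> 1 * (bose_cos 0 - bose_sin 0) + 1 - (ln 2 - 0 + (euler_mascheroni + Ei_series 0))) (at_right 0)"
    by (intro tendsto_add tendsto_diff tendsto_mult bc Ein tendsto_const; real_asymp)
  also have "1 * (bose_cos 0 - bose_sin 0) + 1 - (ln 2 - 0 + (euler_mascheroni + Ei_series 0)) = 0"
    by (simp add: bose_cos_0) (simp add: bose_sin_def)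
  finally have "((\<lambda>s. c) \<longlongrightarrow> 0) (at_right (0::real))"
  proof (rule filterlim_mono_eventually)
    show "\<forall>\<^sub>F s in at_right 0. exp s * (bose_cos s - bose_sin s) + exp s -
        (ln (1 + exp (- s)) - ln ((1 - exp (- s)) / s) + (euler_mascheroni + Ei_series s)) = c"
      using eventually_at_right_less[of 0]
    proof eventually_elim
      fix s :: real assume s: "s > 0"
      have "c = exp s * (bose_cos s - bose_sin s) + exp s - (ln_coth_half s + Ei s)"
        unfolding c[OF s, symmetric] by (simp add: algebra_simps flip: exp_add)
      then show "exp s * (bose_cos s - bose_sin s) + exp s -
          (ln (1 + exp (- s)) - ln ((1 - exp (- s)) / s) + (euler_mascheroni + Ei_series s)) = c"
        using s by (simp add: ln_coth_half_def Ei_eq Ei_primitive_def ln_div)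
    qed
  qed auto
  then have "c = 0" by (simp add: tendsto_const_iff)
  with c[OF s] show ?thesis by simp
qed

lemma bose_cos_closed_form:
  assumes "s > 0"
  shows "bose_cos s = - 1 + cosh s * (ln (1 + exp (- s)) - ln (1 - exp (- s)))
      + exp (- s) / 2 * Ei s + exp s / 2 * Ei (- s)"
proof -
  have "2 * bose_cos s = (bose_cos s + bose_sin s) + (bose_cos s - bose_sin s)" by simp
  also have "\<dots> = 2 * (- 1 + cosh s * ln_coth_half s + exp (- s) / 2 * Ei s + exp s / 2 * Ei (- s))"
    unfolding bose_cos_plus_sin[OF assms] bose_cos_minus_sin[OF assms]
    by (simp add: cosh_field_def field_simps)
  finally show ?thesis by (simp add: ln_coth_half_def)
qed

section \<open>The representing measure\<close>

text \<open>
  The density of the measure in the Pick representation: the even extension of the weight above,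
  divided by \<open>1 + x\<^sup>2\<close>.
\<close>

definition pick_density :: "real \<Rightarrow> real" where
  "pick_density x = \<bar>x\<bar> / (exp (pi * \<bar>x\<bar>) - 1) / (1 + x\<^sup>2)"

definition pick_measure :: "real measure" where
  "pick_measure = density lborel pick_density"

lemma pick_density_nonneg [simp]: "pick_density x \<ge> 0"
  using bose_density_bound(1)[of "\<bar>x\<bar>"] by (cases "x = 0") (auto simp: pick_density_def)

lemma pick_density_measurable [measurable]: "pick_density \<in> borel_measurable borel"
  unfolding pick_density_def [abs_def] by measurable

lemma pick_density_minus [simp]: "pick_density (- x) = pick_density x"
  by (simp add: pick_density_def)

lemma integrable_pick_density: "integrable lborel pick_density"
proof (rule Bochner_Integration.integrable_bound)
  let ?b = "\<lambda>x::real. indicator {0<..} x *\<^sub>R (x / (exp (pi * x) - 1))"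
  have "integrable lborel ?b" using integrable_bose_density by (simp only: set_integrable_def)
  moreover from lborel_integrable_real_affine[OF this, of "- 1" 0]
  have "integrable lborel (\<lambda>x. ?b (- x))" by simp
  ultimately show "integrable lborel (\<lambda>x. ?b x + ?b (- x))"
    by (rule Bochner_Integration.integrable_add)
  have "norm (pick_density x) \<le> norm (?b x + ?b (- x))" for x
  proof (cases "x = 0")
    case False
    let ?d = "\<bar>x\<bar> / (exp (pi * \<bar>x\<bar>) - 1)"
    have d: "?d > 0" using bose_density_bound(1)[of "\<bar>x\<bar>"] False by simp
    then have "norm (pick_density x) \<le> ?d"
      unfolding pick_density_def real_norm_def by (intro div_1_plus_square_le) simp
    also have "?d = ?b x + ?b (- x)" using False by (auto simp: indicator_def)
    finally show ?thesis by simp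
  qed (simp add: pick_density_def)
  then show "AE x in lborel. norm (pick_density x) \<le> norm (?b x + ?b (- x))" by simp
qed simp

interpretation pick: finite_borel_measure pick_measure
proof (intro finite_borel_measure.intro finite_measureI finite_borel_measure_axioms.intro)
  have "(\<integral>\<^sup>+x. ennreal (norm (pick_density x)) \<partial>lborel) < \<infinity>"
    using integrable_pick_density unfolding integrable_iff_bounded by blast
  then show "emeasure pick_measure (space pick_measure) \<noteq> \<infinity>"
    by (simp add: pick_measure_def emeasure_density)
qed (simp add: pick_measure_def)

text \<open>
  Folding the real line at \<open>0\<close> reduces integrals against the even density to integrals against
  \<open>bose_measure\<close>.
\<close>

lemma integral_pick_measure:
  fixes f :: "real \<Rightarrow> complex"
  assumes [measurable]: "f \<in> borel_measurable borel" and bound: "\<And>x. norm (f x) \<le> B"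
  shows "(\<integral>x. f x \<partial>pick_measure) = (\<integral>x. (f x + f (- x)) /\<^sub>R (1 + x\<^sup>2) \<partial>bose_measure)"
proof -
  let ?h = "\<lambda>x. pick_density x *\<^sub>R f x"
  have "integrable pick_measure f"
    by (rule pick.integrable_const_bound[where B = B]) (use bound in \<open>auto simp: pick_measure_def\<close>)
  then have h: "integrable lborel ?h"
    by (simp add: pick_measure_def integrable_density)
  have h': "integrable lborel (\<lambda>x. ?h (- x))"
    using lborel_integrable_real_affine[OF h, of "- 1" 0] by simp
  note ind = integrable_mult_indicator[of "{0<..}" lborel] integrable_mult_indicator[of "{..<0}" lborel]
  have "(\<integral>x. f x \<partial>pick_measure) = (\<integral>x. ?h x \<partial>lborel)"
    by (simp add: pick_measure_def integral_density)
  also have "\<dots> = (\<integral>x. indicator {0<..} x *\<^sub>R ?h x + indicator {..<0} x *\<^sub>R ?h x \<partial>lborel)"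
    by (intro Bochner_Integration.integral_cong) (auto simp: indicator_def pick_density_def)
  also have "\<dots> = (\<integral>x. indicator {0<..} x *\<^sub>R ?h x \<partial>lborel) + (\<integral>x. indicator {..<0} x *\<^sub>R ?h x \<partial>lborel)"
    by (intro Bochner_Integration.integral_add ind h) auto
  also have "(\<integral>x. indicator {..<0} x *\<^sub>R ?h x \<partial>lborel) = (\<integral>x. indicator {0<..} x *\<^sub>R ?h (- x) \<partial>lborel)"
    by (subst lborel_integral_real_affine[of "- 1" _ 0]) (auto simp: indicator_def)
  also have "(\<integral>x. indicator {0<..} x *\<^sub>R ?h x \<partial>lborel) + (\<integral>x. indicator {0<..} x *\<^sub>R ?h (- x) \<partial>lborel) =
      (\<integral>x. indicator {0<..} x *\<^sub>R ?h x + indicator {0<..} x *\<^sub>R ?h (- x) \<partial>lborel)"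
    by (intro Bochner_Integration.integral_add [symmetric] ind h h') auto
  also have "\<dots> = (LINT x:{0<..}|lborel. (x / (exp (pi * x) - 1)) *\<^sub>R ((f x + f (- x)) /\<^sub>R (1 + x\<^sup>2)))"
    unfolding set_lebesgue_integral_def
    by (intro Bochner_Integration.integral_cong)
      (auto simp: indicator_def pick_density_def divide_inverse scaleR_right_distrib)
  also have "\<dots> = (\<integral>x. (f x + f (- x)) /\<^sub>R (1 + x\<^sup>2) \<partial>bose_measure)"
    by (rule integral_bose_measure [symmetric]) measurable
  finally show ?thesis .
qed

lemma char_pick_measure: "char pick_measure s = of_real (bose_cos s)"
proof -
  have "char pick_measure s = (\<integral>x. (iexp (s * x) + iexp (s * - x)) /\<^sub>R (1 + x\<^sup>2) \<partial>bose_measure)"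
    unfolding char_def by (rule integral_pick_measure[where B = 1]) auto
  also have "\<dots> = (\<integral>x. of_real (2 * (cos (s * x) / (1 + x\<^sup>2))) \<partial>bose_measure)"
    by (intro Bochner_Integration.integral_cong)
      (auto simp: complex_eq_iff Re_exp Im_exp scaleR_conv_of_real divide_inverse)
  also have "\<dots> = of_real (bose_cos s)"
    by (simp only: bose_cos_def integral_mult_right_zero integral_complex_of_real)
  finally show ?thesis .
qed

lemma measure_pick_measure: "measure pick_measure UNIV = euler_mascheroni + ln 2 - 1"
proof -
  have "char pick_measure 0 = of_real (measure pick_measure UNIV)"
    by (simp add: char_def scaleR_conv_of_real pick.borel_UNIV)
  then show ?thesis unfolding char_pick_measure bose_cos_0 by (metis of_real_eq_iff)
qed

text \<open>
  Only the part of the kernel that is even in \<open>x\<close> survives the folding. It equals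
  \<open>- \<i> * t * (1 + x\<^sup>2) / (x\<^sup>2 + t\<^sup>2)\<close>, whose factor \<open>1 + x\<^sup>2\<close> cancels against the density and leaves
  Binet's integrand.
\<close>

lemma pick_kernel_integral:
  fixes t :: real
  assumes t: "t \<noteq> 0"
  shows "(CLINT x|pick_measure. (1 + \<i> * of_real t * of_real x) / (\<i> * of_real t - of_real x)) =
    - (\<i> * of_real (t * (2 * (\<integral>x. 1 / (x\<^sup>2 + t\<^sup>2) \<partial>bose_measure))))"
proof -
  let ?f = "\<lambda>x::real. (1 + \<i> * of_real t * of_real x) / (\<i> * of_real t - of_real x)"
  have nz: "\<i> * of_real t - complex_of_real x \<noteq> 0" for x
    using t by (auto simp: complex_eq_iff)
  have bound: "norm (?f x) \<le> \<bar>t\<bar> + 1 / \<bar>t\<bar>" for x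
  proof -
    have "(cmod (1 + \<i> * of_real t * of_real x))\<^sup>2 \<le> ((\<bar>t\<bar> + 1 / \<bar>t\<bar>) * cmod (\<i> * of_real t - of_real x))\<^sup>2"
    proof -
      have "(cmod (1 + \<i> * of_real t * of_real x))\<^sup>2 = 1 + t\<^sup>2 * x\<^sup>2"
        by (simp add: cmod_power2 power_mult_distrib)
      also have "\<dots> \<le> (t\<^sup>2 + 2 + 1 / t\<^sup>2) * (t\<^sup>2 + x\<^sup>2)"
        using t by (simp add: algebra_simps add_increasing)
      also have "t\<^sup>2 + 2 + 1 / t\<^sup>2 = (\<bar>t\<bar> + 1 / \<bar>t\<bar>)\<^sup>2"
        using t by (simp add: power2_sum power_divide)
      also have "t\<^sup>2 + x\<^sup>2 = (cmod (\<i> * of_real t - of_real x))\<^sup>2"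
        by (simp add: cmod_power2)
      finally show ?thesis by (simp add: power_mult_distrib)
    qed
    then have "cmod (1 + \<i> * of_real t * of_real x) \<le> (\<bar>t\<bar> + 1 / \<bar>t\<bar>) * cmod (\<i> * of_real t - of_real x)"
      by (rule power2_le_imp_le) simp
    then show ?thesis using nz[of x] by (simp add: norm_divide divide_le_eq)
  qed
  have "(CLINT x|pick_measure. ?f x) = (\<integral>x. (?f x + ?f (- x)) /\<^sub>R (1 + x\<^sup>2) \<partial>bose_measure)"
    by (rule integral_pick_measure[OF _ bound]) measurable
  also have "\<dots> = (\<integral>x. - (\<i> * of_real t) * of_real (2 * (1 / (x\<^sup>2 + t\<^sup>2))) \<partial>bose_measure)"
  proof (intro Bochner_Integration.integral_cong refl)
    fix x :: real
    have p: "1 + x\<^sup>2 > 0" "x\<^sup>2 + t\<^sup>2 > 0" using t by (auto simp: add_pos_nonneg add_nonneg_pos)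
    have "?f x + ?f (- x) = - (2 * \<i> * of_real t * of_real (1 + x\<^sup>2)) / of_real (x\<^sup>2 + t\<^sup>2)"
    proof -
      have "(\<i> * of_real t - of_real x) * (\<i> * of_real t - of_real (- x)) = - complex_of_real (x\<^sup>2 + t\<^sup>2)"
        by (simp add: algebra_simps power2_eq_square)
      moreover have "(1 + \<i> * of_real t * of_real x) * (\<i> * of_real t - of_real (- x)) +
          (1 + \<i> * of_real t * of_real (- x)) * (\<i> * of_real t - of_real x) =
          2 * \<i> * of_real t * of_real (1 + x\<^sup>2)"
        by (simp add: algebra_simps power2_eq_square)
      ultimately show ?thesis
        unfolding add_frac_eq[OF nz nz] by (simp only: divide_minus_right minus_divide_left)
    qed
    then have "(?f x + ?f (- x)) /\<^sub>R (1 + x\<^sup>2) = - (\<i> * of_real t) *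
        (2 * (of_real (inverse (1 + x\<^sup>2)) * of_real (1 + x\<^sup>2)) / of_real (x\<^sup>2 + t\<^sup>2))"
      by (simp only: scaleR_conv_of_real) (simp only: times_divide_eq_right mult_minus_left mult_minus_right mult_ac)
    also have "complex_of_real (inverse (1 + x\<^sup>2)) * of_real (1 + x\<^sup>2) = 1"
      unfolding of_real_mult [symmetric] using p(1) by simp
    finally show "(?f x + ?f (- x)) /\<^sub>R (1 + x\<^sup>2) = - (\<i> * of_real t) * of_real (2 * (1 / (x\<^sup>2 + t\<^sup>2)))"
      by simp
  qed
  also have "\<dots> = - (\<i> * of_real t) * of_real (2 * (\<integral>x. 1 / (x\<^sup>2 + t\<^sup>2) \<partial>bose_measure))"
    by (simp only: integral_mult_right_zero integral_complex_of_real)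
  finally show ?thesis by simp
qed

theorem proposition2:
  fixes V :: "complex \<Rightarrow> complex"
  assumes V_upper: "\<And>t::real. t > 0 \<Longrightarrow>
      V (\<i> * of_real t) = \<i> * of_real (t * Digamma (t / 2) - t * ln (t / 2) + 1)"
    and V_lower: "\<And>t::real. t > 0 \<Longrightarrow> V (- (\<i> * of_real t)) = cnj (V (\<i> * of_real t))"
  shows "\<exists>(a::real) (m::real measure).
      finite_borel_measure m \<and>
      (\<forall>t::real. t \<noteq> 0 \<longrightarrow>
         V (\<i> * of_real t) =
           of_real a +
           (CLINT x|m. (1 + \<i> * of_real t * of_real x) / (\<i> * of_real t - of_real x))) \<and>
      a = 0 \<and>
      measure m UNIV = euler_mascheroni + ln 2 - 1 \<and>
      (\<forall>s>0.
         char m s = of_real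
           (- 1 + cosh s * (ln (1 + exp (- s)) - ln (1 - exp (- s)))
            + exp (- s) / 2 * Ei s + exp s / 2 * Ei (- s)) \<and>
         - 1 + cosh s * (ln (1 + exp (- s)) - ln (1 - exp (- s)))
            + exp (- s) / 2 * Ei s + exp s / 2 * Ei (- s) =
         2 * (LINT x:{0<..}|lborel. cos (s * x) * (x / (1 + x\<^sup>2)) * (1 / (exp (pi * x) - 1))))"
proof (intro exI conjI allI impI)
  show "finite_borel_measure pick_measure" by unfold_locales
  show "measure pick_measure UNIV = euler_mascheroni + ln 2 - 1" by (rule measure_pick_measure)
  show "(0::real) = 0" ..
next
  fix s :: real assume s: "s > 0"
  show "char pick_measure s = of_real (- 1 + cosh s * (ln (1 + exp (- s)) - ln (1 - exp (- s)))
      + exp (- s) / 2 * Ei s + exp s / 2 * Ei (- s))"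
    unfolding char_pick_measure bose_cos_closed_form[OF s] ..
  show "- 1 + cosh s * (ln (1 + exp (- s)) - ln (1 - exp (- s)))
      + exp (- s) / 2 * Ei s + exp s / 2 * Ei (- s) =
      2 * (LINT x:{0<..}|lborel. cos (s * x) * (x / (1 + x\<^sup>2)) * (1 / (exp (pi * x) - 1)))"
    unfolding bose_cos_closed_form[OF s, symmetric] bose_cos_def
    by (subst integral_bose_measure) (simp_all add: mult_ac)
next
  fix t :: real assume t: "t \<noteq> 0"
  let ?K = "\<lambda>t::real. 2 * (\<integral>x. 1 / (x\<^sup>2 + t\<^sup>2) \<partial>bose_measure)"
  have upper: "V (\<i> * of_real u) = - (\<i> * of_real (u * ?K u))" if "u > 0" for u
  proof -
    have "u * Digamma (u / 2) - u * ln (u / 2) + 1 = - (u * ?K u)"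
      unfolding binet_Digamma[OF that] using that by (simp add: field_simps)
    with V_upper[OF that] show ?thesis by simp
  qed
  have "V (\<i> * of_real t) = - (\<i> * of_real (t * ?K t))"
  proof (cases "t > 0")
    case False
    with t have "- t > 0" by simp
    from V_lower[OF this] upper[OF this] show ?thesis by simp
  qed (rule upper)
  then show "V (\<i> * of_real t) = of_real 0 +
      (CLINT x|pick_measure. (1 + \<i> * of_real t * of_real x) / (\<i> * of_real t - of_real x))"
    unfolding pick_kernel_integral[OF t] by simp
qed

end
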